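(* Let $n$ be even. The class $[qA]_b\in\mathrm{H}_b^n(\mathrm{GL}_n(\mathbb{R}),\mathbb{R}_\varepsilon)$ defined by the cocycle $A$ has canonical semi-norm $\|[qA]_b\|=1$.
   Context: $\mathbb{R}_\varepsilon$ is $\mathbb{R}$ with $g\in\mathrm{GL}_n(\mathbb{R})$ acting by $\operatorname{sign}\det g$. $\mathcal{F}(\mathbb{R}^n)$ is the space of complete flags with its $\mathrm{GL}_n(\mathbb{R})$-quasi-invariant measure class; $\mathrm{H}_b^\bullet(\mathrm{GL}_n(\mathbb{R}),\mathbb{R}_\varepsilon)$ (continuous bounded cohomology with its canonical semi-norm) is isometrically computed by the complex of $\mathrm{GL}_n(\mathbb{R})$-equivariant elements of $L^\infty(\mathcal{F}(\mathbb{R}^n)^{\bullet+1},\mathbb{R}_\varepsilon)$, and $[qA]_b$ is the class of the a.e.-class $qA$ of $A$. Definition of $A$: a complete oriented flag is a complete flag with a chosen open half-space $(F^i)^+$ of $F^i$ bounded by $F^{i-1}$ for each $i$ (inducing compatible orientations: $(v_1,\dots,v_{i-1},x)$ positive in $F^i$ iff $(v_1,\dots,v_{i-1})$ positive in $F^{i-1}$ and $x\in(F^i)^+$). For an oriented $k$-dimensional subspace $W$ ($0\le k\le n-1$) and oriented flag $F$, with $d$ the unique $1\le d\le k+1$ such that $F^{d-1}\subseteq W$, $F^d\not\subseteq W$, $[W,F]$ is $W+F^d$ oriented by a positive basis of $W$ followed by $x\in(F^d)^+$; $[F_1]=F_1^1$, $[F_1,\dots,F_k]=[[F_1,\dots,F_{k-1}],F_k]$.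 $\mathrm{Or}(U)\in\{\pm1\}$ is the sign of an orientation $U$ of $\mathbb{R}^n$ relative to the canonical one. $E(F_0,\dots,F_n)=\prod_{i=0}^n\mathrm{Or}([F_0,\dots,\widehat{F_i},\dots,F_n])$ for oriented flags, and $A(F_0,\dots,F_n)=2^{-n(n+1)}\sum E(F_0',\dots,F_n')$ over all oriented lifts $F_i'$ of the flags $F_i$. $A$ is a $\mathrm{GL}_n(\mathbb{R})$-equivariant everywhere-defined Borel cocycle. *)

theory Defs
  imports "HOL-Analysis.Analysis"
begin

text \<open>Ambient space: (real,'n) vec with n = CARD('n). The linear order on 'n fixes the
  ordering of the standard basis, hence the canonical orientation of R^n.\<close>

type_synonym 'n flag = "nat \<Rightarrow> ((real,'n) vec) set"
type_synonym 'n halves = "nat \<Rightarrow> ((real,'n) vec) set"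

definition rk :: "'n::{finite,linorder} \<Rightarrow> nat" where
  "rk c = card {c'. c' < c}"

text \<open>Complete flags: F 0 = {0} \<subseteq> F 1 \<subseteq> ... \<subseteq> F n = UNIV, dim (F i) = i,
  normalised by F i = UNIV for i \<ge> n.\<close>
definition is_flag :: "'n::{finite,linorder} flag \<Rightarrow> bool" where
  "is_flag F \<longleftrightarrow> (\<forall>i. subspace (F i) \<and> dim (F i) = min i CARD('n)) \<and> (\<forall>i. F i \<subseteq> F (Suc i))"

definition flags :: "'n::{finite,linorder} flag set" where
  "flags = {F. is_flag F}"

definition is_half :: "'n::{finite,linorder} flag \<Rightarrow> nat \<Rightarrow> ((real,'n) vec) set \<Rightarrow> bool" where
  "is_half F i H \<longleftrightarrow>
     (\<exists>x \<in> F i - F (i - 1). H = {u + t *\<^sub>R x | u t. u \<in> F (i - 1) \<and> t > 0})"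

definition lifts :: "'n::{finite,linorder} flag \<Rightarrow> 'n halves set" where
  "lifts F = {H. (\<forall>i \<in> {1..CARD('n)}. is_half F i (H i)) \<and> (\<forall>i. i \<notin> {1..CARD('n)} \<longrightarrow> H i = {})}"

text \<open>Or of an orientation of R^n given by an ordered (positive) basis bs.\<close>
definition Or :: "(real,'n::{finite,linorder}) vec list \<Rightarrow> real" where
  "Or bs = sgn (det (\<chi> r c. (bs ! rk c) $ r :: ((real,'n) vec,'n) vec))"

text \<open>[W,F]: W oriented subspace given by a positive basis ws; F an oriented flag.\<close>
definition brstep :: "(real,'n::{finite,linorder}) vec list \<Rightarrow> 'n flag \<times> 'n halves \<Rightarrow> ((real,'n) vec) list" where
  "brstep ws FH = (let d = (LEAST d. \<not> fst FH d \<subseteq> span (set ws)) in ws @ [SOME x. x \<in> snd FH d])"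

text \<open>[F_1, ..., F_k] (the first step gives F_1^1 oriented by (F_1^1)^+).\<close>
definition br :: "('n::{finite,linorder} flag \<times> 'n halves) list \<Rightarrow> ((real,'n) vec) list" where
  "br Fs = foldl brstep [] Fs"

definition E :: "(nat \<Rightarrow> 'n::{finite,linorder} flag \<times> 'n halves) \<Rightarrow> real" where
  "E X = (\<Prod>i\<le>CARD('n). Or (br (map X ([0..<i] @ [Suc i..<Suc CARD('n)]))))"

definition cocA :: "(nat \<Rightarrow> 'n::{finite,linorder} flag) \<Rightarrow> real" where
  "cocA Fs = (1 / 2 ^ (CARD('n) * (CARD('n) + 1))) *
     (\<Sum>H \<in> PiE {..CARD('n)} (\<lambda>i. lifts (Fs i)). E (\<lambda>i. (Fs i, H i)))"

definition act :: "((real,'n) vec,'n) vec \<Rightarrow> 'n::{finite,linorder} flag \<Rightarrow> 'n flag" where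
  "act g F = (\<lambda>i. (\<lambda>v. g *v v) ` F i)"

definition eps :: "((real,'n::finite) vec,'n) vec \<Rightarrow> real" where
  "eps g = sgn (det g)"

text \<open>Measure class on tuples of flags: pulled back from Lebesgue measure on
  tuples of matrices via g \<mapsto> flag spanned by the ordered columns of g.\<close>
definition flag_of :: "((real,'n) vec,'n) vec \<Rightarrow> 'n::{finite,linorder} flag" where
  "flag_of g = (\<lambda>i. span {column c g | c. rk c < i})"

definition ftuples :: "nat \<Rightarrow> (nat \<Rightarrow> 'n::{finite,linorder} flag) set" where
  "ftuples k = PiE {..<k} (\<lambda>_. flags)"

definition Mk :: "nat \<Rightarrow> (nat \<Rightarrow> ((real,'n::finite) vec,'n) vec) measure" where
  "Mk k = PiM {..<k} (\<lambda>_. lborel)"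

definition tuple_of :: "nat \<Rightarrow> (nat \<Rightarrow> ((real,'n) vec,'n) vec) \<Rightarrow> (nat \<Rightarrow> 'n::{finite,linorder} flag)" where
  "tuple_of k gs = restrict (\<lambda>j. flag_of (gs j)) {..<k}"

definition negl :: "nat \<Rightarrow> (nat \<Rightarrow> 'n::{finite,linorder} flag) set \<Rightarrow> bool" where
  "negl k S \<longleftrightarrow> (\<exists>N \<in> null_sets (Mk k :: (nat \<Rightarrow> ((real,'n) vec,'n) vec) measure).
     {gs \<in> space (Mk k). (\<forall>j<k. invertible (gs j)) \<and> tuple_of k gs \<in> S} \<subseteq> N)"

definition fmeas :: "nat \<Rightarrow> ((nat \<Rightarrow> 'n::{finite,linorder} flag) \<Rightarrow> real) \<Rightarrow> bool" where
  "fmeas k f \<longleftrightarrow> (\<lambda>gs. f (tuple_of k gs)) \<in> borel_measurable (completion (Mk k))"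

definition ess_bdd :: "nat \<Rightarrow> ((nat \<Rightarrow> 'n::{finite,linorder} flag) \<Rightarrow> real) \<Rightarrow> bool" where
  "ess_bdd k f \<longleftrightarrow> (\<exists>C. negl k {Fs \<in> ftuples k. C < \<bar>f Fs\<bar>})"

definition ess_norm :: "nat \<Rightarrow> ((nat \<Rightarrow> 'n::{finite,linorder} flag) \<Rightarrow> real) \<Rightarrow> real" where
  "ess_norm k f = Inf {C. 0 \<le> C \<and> negl k {Fs \<in> ftuples k. C < \<bar>f Fs\<bar>}}"

definition equivar :: "nat \<Rightarrow> ((nat \<Rightarrow> 'n::{finite,linorder} flag) \<Rightarrow> real) \<Rightarrow> bool" where
  "equivar k f \<longleftrightarrow> (\<forall>g :: ((real,'n) vec,'n) vec. invertible g \<longrightarrow>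
     negl k {Fs \<in> ftuples k. f (restrict (\<lambda>j. act g (Fs j)) {..<k}) \<noteq> eps g * f Fs})"

definition LinfG :: "nat \<Rightarrow> ((nat \<Rightarrow> 'n::{finite,linorder} flag) \<Rightarrow> real) set" where
  "LinfG k = {f. fmeas k f \<and> ess_bdd k f \<and> equivar k f}"

definition cobound :: "nat \<Rightarrow> ((nat \<Rightarrow> 'a) \<Rightarrow> real) \<Rightarrow> (nat \<Rightarrow> 'a) \<Rightarrow> real" where
  "cobound k \<beta> Fs = (\<Sum>i<k. (-1) ^ i * \<beta> (restrict (\<lambda>j. if j < i then Fs j else Fs (Suc j)) {..<k - 1}))"

text \<open>Canonical semi-norm of [qA]_b in H_b^n(GL_n(R), R_eps), computed isometrically
  by the complex of equivariant L^infinity functions on flags: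
  inf of ||qA - d beta||_infinity over equivariant beta in L^infinity(F^n).\<close>
definition qA_norm :: "'n::{finite,linorder} itself \<Rightarrow> real" where
  "qA_norm t = Inf {ess_norm (CARD('n) + 1) (\<lambda>Fs. cocA Fs - cobound (CARD('n) + 1) \<beta> Fs) | \<beta>.
                    \<beta> \<in> (LinfG CARD('n) :: ((nat \<Rightarrow> 'n flag) \<Rightarrow> real) set)}"

end

theory Submission
  imports Defs "HOL-Probability.Probability"
begin

text \<open>
  For lines in general position the orientations of the flags cancel, because \<open>n\<close> is even:
  \<open>A = \<plusminus>1\<close> there, and \<open>\<bar>A\<bar> \<le> 1\<close> everywhere. It remains to see that no equivariant \<open>\<beta>\<close> lowers the norm.

  Take \<open>n + 1\<close> vectors \<open>v\<^sub>0, \<dots>, v\<^sub>n\<close> in general position with sum zero, indexed cyclically, and let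
  \<open>F\<^sub>j\<close> be the flag spanned by \<open>v\<^sub>j, v\<^bsub>j-1\<^esub>, v\<^bsub>j-2\<^esub>, \<dots>\<close>. The reflection that negates \<open>v\<^bsub>i+1\<^esub>\<close>
  and fixes the vectors other than \<open>v\<^sub>i\<close>, \<open>v\<^bsub>i+1\<^esub>\<close> preserves all flags but \<open>F\<^sub>i\<close>: coming from \<open>j \<noteq> i\<close>,
  one meets \<open>v\<^bsub>i+1\<^esub>\<close> before \<open>v\<^sub>i\<close>. An everywhere equivariant \<open>\<beta>\<close> would therefore vanish on all faces
  of \<open>(F\<^sub>0, \<dots>, F\<^sub>n)\<close>, whereas \<open>A = \<plusminus>1\<close> at this point.

  As \<open>\<beta>\<close> is only defined almost everywhere, the tuple is replaced by random flags. Writing \<open>B\<^sub>j\<close> for the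
  matrix with columns \<open>v\<^sub>j, h v\<^bsub>j-1\<^esub>, h\<^sup>2 v\<^bsub>j-2\<^esub>, \<dots>\<close>, take the flags of \<open>B\<^sub>j X\<^sub>j\<close> with independent
  uniform \<open>X\<^sub>j\<close> in a set of matrices invariant under sign changes of the rows. As \<open>h \<rightarrow> 0\<close> the lines of these
  flags tend to those of the \<open>v\<^sub>j\<close>, and the reflections, read in the basis \<open>B\<^sub>j\<close>, tend to diagonal sign matrices.
  Hence each face is asymptotically invariant in total variation, so that the mean of \<open>\<beta>\<close> over it
  tends to zero, while the mean of \<open>A\<close> tends to \<open>\<plusminus>1\<close>.
\<close>

section \<open>Scaling of Lebesgue measure under linear maps\<close>

lemma emeasure_lborel_open_pos:
  fixes S :: "'a::euclidean_space set"
  assumes "open S" "S \<noteq> {}"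
  shows "0 < emeasure lborel S"
proof -
  have "S \<notin> null_sets lborel"
    using open_not_negligible[OF assms] null_sets_completionI by (auto simp: negligible_iff_null_sets)
  moreover have "S \<in> sets lborel" using assms(1) by simp
  ultimately show ?thesis by (simp add: null_sets_def zero_less_iff_neq_zero)
qed

lemma nn_integral_lborel_shift:
  fixes h :: "'a::euclidean_space \<Rightarrow> ennreal"
  assumes [measurable]: "h \<in> borel_measurable borel"
  shows "(\<integral>\<^sup>+x. h (a + x) \<partial>lborel) = (\<integral>\<^sup>+x. h x \<partial>lborel)"
proof -
  have "(\<integral>\<^sup>+x. h x \<partial>lborel) = (\<integral>\<^sup>+x. h x \<partial>(distr lborel borel ((+) a)))"
    by (simp add: lborel_distr_plus)
  also have "\<dots> = (\<integral>\<^sup>+x. h (a + x) \<partial>lborel)"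
    by (subst nn_integral_distr) auto
  finally show ?thesis by simp
qed

text \<open>Fubini proof of the uniqueness of Haar measure: for the unit ball \<open>B\<close>, the products
  \<open>\<lambda>(f\<inverse>A) \<lambda>(B)\<close> and \<open>\<lambda>(A) \<lambda>(f\<inverse>B)\<close> are both equal to the double integral
  of \<open>1\<^sub>A(f x + y) 1\<^sub>B(y)\<close>.\<close>
lemma lborel_linear_vimage:
  fixes f :: "'a::euclidean_space \<Rightarrow> 'a"
  assumes lin: "linear f" and inj: "inj f"
  obtains c :: real where "c > 0"
    "\<And>A. A \<in> sets borel \<Longrightarrow> emeasure lborel (f -` A) = ennreal c * emeasure lborel A"
proof -
  have surj: "surj f"
    using lin inj by (rule linear_inj_imp_surj)
  have cont: "continuous_on UNIV f"
    by (simp add: lin linear_continuous_on linear_conv_bounded_linear[symmetric])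
  have [measurable]: "f \<in> borel_measurable borel"
    using cont by (rule borel_measurable_continuous_onI)
  define B :: "'a set" where "B = ball 0 1"
  have [measurable]: "B \<in> sets borel" by (simp add: B_def)
  have B_sym: "- x \<in> B \<longleftrightarrow> x \<in> B" for x by (simp add: B_def dist_norm)
  have fB: "emeasure lborel (f -` S) = (\<integral>\<^sup>+x. indicator S (f x) \<partial>lborel)"
    if [measurable]: "S \<in> sets borel" for S
  proof -
    have "f -` S \<in> sets borel"
      using measurable_sets_borel[OF \<open>f \<in> borel_measurable borel\<close> that] by simp
    then have "emeasure lborel (f -` S) = (\<integral>\<^sup>+x. indicator (f -` S) x \<partial>lborel)"
      by (subst nn_integral_indicator) auto
    then show ?thesis by (simp add: indicator_def vimage_def)
  qed
  have main: "emeasure lborel (f -` A) * emeasure lborel B = emeasure lborel A * emeasure lborel (f -` B)"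
    if [measurable]: "A \<in> sets borel" for A
  proof -
    \<comment> \<open>Since f is surjective, a translation by y in the target comes from a
      translation by a preimage of y in the source, where Lebesgue measure is invariant.\<close>
    have shiftA: "(\<integral>\<^sup>+x. indicator A (f x) \<partial>lborel) = (\<integral>\<^sup>+x. indicator A (f x + y) \<partial>lborel)" for y
    proof -
      obtain z where z: "y = f z" using surj by blast
      show ?thesis
        using nn_integral_lborel_shift[of "\<lambda>x. indicator A (f x)" z]
        by (simp add: z linear_add[OF lin] add.commute)
    qed
    \<comment> \<open>The same substitution turns y - f x into - f x, and the symmetry of the ball
      removes the sign.\<close>
    have shiftB: "(\<integral>\<^sup>+x. indicator B (y - f x) \<partial>lborel) = (\<integral>\<^sup>+x. indicator B (f x) \<partial>lborel)" for y
    proof -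
      obtain z where z: "y = f z" using surj by blast
      have "(\<integral>\<^sup>+x. indicator B (y - f x) \<partial>lborel) = (\<integral>\<^sup>+x. indicator B (y - f (z + x)) \<partial>lborel)"
        using nn_integral_lborel_shift[of "\<lambda>x. indicator B (y - f x)" z] by simp
      also have "\<dots> = (\<integral>\<^sup>+x. indicator B (f x) \<partial>lborel)"
        by (intro nn_integral_cong) (simp add: z linear_add[OF lin] indicator_def B_sym)
      finally show ?thesis .
    qed
    have "emeasure lborel (f -` A) * emeasure lborel B
        = (\<integral>\<^sup>+y. (\<integral>\<^sup>+x. indicator A (f x) \<partial>lborel) * indicator B y \<partial>lborel)"
      by (simp add: fB nn_integral_cmult)
    also have "\<dots> = (\<integral>\<^sup>+y. (\<integral>\<^sup>+x. indicator A (f x + y) * indicator B y \<partial>lborel) \<partial>lborel)"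
      by (intro nn_integral_cong) (subst nn_integral_multc, simp_all flip: shiftA)
    also have "\<dots> = (\<integral>\<^sup>+x. (\<integral>\<^sup>+y. indicator A (f x + y) * indicator B y \<partial>lborel) \<partial>lborel)"
      by (rule lborel_pair.Fubini') measurable
    also have "\<dots> = (\<integral>\<^sup>+x. (\<integral>\<^sup>+y. indicator A y * indicator B (y - f x) \<partial>lborel) \<partial>lborel)"
      using nn_integral_lborel_shift[of "\<lambda>y. indicator A y * indicator B (y - f x)" "f x" for x]
      by simp
    also have "\<dots> = (\<integral>\<^sup>+y. (\<integral>\<^sup>+x. indicator A y * indicator B (y - f x) \<partial>lborel) \<partial>lborel)"
      by (rule lborel_pair.Fubini') measurable
    also have "\<dots> = (\<integral>\<^sup>+y. indicator A y * (\<integral>\<^sup>+x. indicator B (f x) \<partial>lborel) \<partial>lborel)"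
      by (intro nn_integral_cong) (subst nn_integral_cmult, simp_all add: shiftB)
    also have "\<dots> = emeasure lborel A * emeasure lborel (f -` B)"
      by (simp add: fB nn_integral_multc)
    finally show ?thesis .
  qed
  have B_fin: "emeasure lborel B < \<infinity>" unfolding B_def by (rule emeasure_lborel_ball_finite)
  have op: "open (f -` B)" using cont by (simp add: B_def open_vimage)
  have "f 0 = 0" using lin by (rule linear_0)
  then have ne: "0 \<in> f -` B" by (simp add: B_def)
  have B_pos: "emeasure lborel B > 0" by (rule emeasure_lborel_open_pos) (auto simp: B_def)
  have fB_pos: "emeasure lborel (f -` B) > 0" using op ne by (intro emeasure_lborel_open_pos) auto
  obtain g where g: "linear g" "g \<circ> f = id"
    using linear_injective_left_inverse[OF lin inj] by blast
  \<comment> \<open>The left inverse g is bounded linear, so this bounds the preimage and makes its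
    measure finite; only then can the ratio q / p be formed.\<close>
  have "f -` B \<subseteq> g ` B"
    using g by (auto simp: fun_eq_iff) (metis image_eqI)
  moreover have "bounded (g ` B)"
    using g(1) by (simp add: B_def bounded_linear_image linear_conv_bounded_linear)
  ultimately have "bounded (f -` B)" by (rule bounded_subset[rotated])
  then have fB_fin: "emeasure lborel (f -` B) < \<infinity>"
    by (rule emeasure_bounded_finite)
  obtain p where p: "emeasure lborel B = ennreal p" "p > 0"
    using B_fin B_pos by (cases "emeasure lborel B") auto
  obtain q where q: "emeasure lborel (f -` B) = ennreal q" "q > 0"
    using fB_fin fB_pos by (cases "emeasure lborel (f -` B)") auto
  show thesis
  proof
    show "q / p > 0" using p q by simp
    fix A :: "'a set" assume "A \<in> sets borel"
    from main[OF this] have "emeasure lborel (f -` A) * ennreal p = emeasure lborel A * ennreal q"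
      by (simp add: p q)
    then have "emeasure lborel (f -` A) * ennreal p / ennreal p = emeasure lborel A * ennreal q / ennreal p"
      by simp
    moreover have "emeasure lborel (f -` A) * ennreal p / ennreal p = emeasure lborel (f -` A)"
      using p(2) by (intro mult_divide_eq_ennreal) auto
    moreover have "ennreal (q / p) = ennreal q / ennreal p"
      using p q by (simp add: divide_ennreal)
    ultimately show "emeasure lborel (f -` A) = ennreal (q / p) * emeasure lborel A"
      by (simp add: mult.commute ennreal_times_divide)
  qed
qed

text \<open>On boxes the factors of the coordinates multiply. Since \<open>PiM_eqI\<close>
  characterises the unscaled product measure, the image measure is first divided by the total
  factor, and the factor is restored at the end.\<close>

lemma distr_PiM_scale:
  fixes T :: "'i \<Rightarrow> 'a::euclidean_space \<Rightarrow> 'a" and c :: "'i \<Rightarrow> real"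
  assumes I: "finite I"
    and T[measurable]: "\<And>i. i \<in> I \<Longrightarrow> T i \<in> borel_measurable borel"
    and c: "\<And>i. i \<in> I \<Longrightarrow> c i > 0"
    and sc: "\<And>i A. i \<in> I \<Longrightarrow> A \<in> sets borel \<Longrightarrow>
               emeasure lborel (T i -` A) = ennreal (c i) * emeasure lborel A"
  shows "distr (PiM I (\<lambda>_. lborel)) (PiM I (\<lambda>_. lborel)) (\<lambda>X. \<lambda>i\<in>I. T i (X i))
       = scale_measure (ennreal (prod c I)) (PiM I (\<lambda>_. lborel :: 'a measure))"
    (is "distr ?M ?M ?T = scale_measure ?c ?M")
proof -
  interpret product_sigma_finite "\<lambda>_::'i. lborel :: 'a measure" by standard
  have meas[measurable]: "?T \<in> measurable ?M ?M"
    by (rule measurable_restrict) (use T in measurable)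
  have cpos: "prod c I > 0" using c by (simp add: prod_pos)
  have cc: "ennreal (1 / prod c I) * ?c = 1" "?c * ennreal (1 / prod c I) = 1"
    using cpos by (simp_all flip: ennreal_mult)
  have eq: "scale_measure (ennreal (1 / prod c I)) (distr ?M ?M ?T) = ?M"
  proof (rule PiM_eqI[OF I])
    show "sets (scale_measure (ennreal (1 / prod c I)) (distr ?M ?M ?T)) = sets ?M" by simp
    fix A :: "'i \<Rightarrow> 'a set" assume A: "\<And>i. i \<in> I \<Longrightarrow> A i \<in> sets lborel"
    have PA: "PiE I A \<in> sets ?M" using I A by (intro sets_PiM_I_finite) auto
    have "?T -` PiE I A \<inter> space ?M = PiE I (\<lambda>i. T i -` A i)"
      by (auto simp: space_PiM PiE_iff extensional_def)
    then have "emeasure (distr ?M ?M ?T) (PiE I A) = emeasure ?M (PiE I (\<lambda>i. T i -` A i))"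
      by (simp add: emeasure_distr PA)
    also have "\<dots> = (\<Prod>i\<in>I. emeasure lborel (T i -` A i))"
      using I A measurable_sets[OF T] by (subst emeasure_PiM) auto
    also have "\<dots> = (\<Prod>i\<in>I. ennreal (c i) * emeasure lborel (A i))"
      using A by (intro prod.cong) (auto simp: sc)
    also have "\<dots> = ?c * (\<Prod>i\<in>I. emeasure lborel (A i))"
      using c by (simp add: prod.distrib prod_ennreal less_imp_le)
    finally show "emeasure (scale_measure (ennreal (1 / prod c I)) (distr ?M ?M ?T)) (PiE I A)
        = (\<Prod>i\<in>I. emeasure lborel (A i))"
      by (simp add: mult.assoc[symmetric] cc)
  qed
  have "scale_measure ?c ?M = scale_measure ?c (scale_measure (ennreal (1 / prod c I)) (distr ?M ?M ?T))"
    by (simp add: eq)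
  also have "\<dots> = distr ?M ?M ?T"
    by (simp add: scale_scale_measure cc)
  finally show ?thesis by simp
qed

section \<open>Flags, lifts and the cocycle on generic tuples\<close>

lemma rk_less: "rk (c :: 'n::{finite,linorder}) < CARD('n)"
  unfolding rk_def by (rule psubset_card_mono) auto

lemma rk_strict_mono: "a < b \<Longrightarrow> rk (a :: 'n::{finite,linorder}) < rk b"
  unfolding rk_def by (rule psubset_card_mono) auto

lemma rk_eq_iff [simp]: "rk a = rk b \<longleftrightarrow> a = (b :: 'n::{finite,linorder})"
  using rk_strict_mono[of a b] rk_strict_mono[of b a] by (cases a b rule: linorder_cases) auto

lemma bij_betw_rk: "bij_betw (rk :: 'n::{finite,linorder} \<Rightarrow> nat) UNIV {..<CARD('n)}"
proof -
  have inj: "inj (rk :: 'n \<Rightarrow> nat)" by (auto intro: injI)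
  moreover have "range (rk :: 'n \<Rightarrow> nat) = {..<CARD('n)}"
    by (rule card_subset_eq) (use inj in \<open>auto simp: rk_less card_image\<close>)
  ultimately show ?thesis by (simp add: bij_betw_def)
qed

definition unrk :: "nat \<Rightarrow> 'n::{finite,linorder}" where
  "unrk = inv_into UNIV rk"

lemma unrk_rk [simp]: "unrk (rk c) = (c :: 'n::{finite,linorder})"
  unfolding unrk_def by (rule inv_into_f_f) (auto intro: injI)

lemma rk_unrk [simp]: "k < CARD('n) \<Longrightarrow> rk (unrk k :: 'n::{finite,linorder}) = k"
  unfolding unrk_def using bij_betw_rk[where 'n='n]
  by (intro f_inv_into_f) (simp add: bij_betw_def)

lemma rk_eq_0_iff: "rk c = 0 \<longleftrightarrow> c = (unrk 0 :: 'n::{finite,linorder})"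
  by (metis rk_unrk unrk_rk zero_less_card_finite)

lemma card_rk_less: "card {c :: 'n::{finite,linorder}. rk c < i} = min i CARD('n)"
proof -
  have "bij_betw rk {c :: 'n. rk c < i} {..<min i CARD('n)}"
    unfolding bij_betw_def
  proof
    show "rk ` {c :: 'n. rk c < i} = {..<min i CARD('n)}"
    proof (intro equalityI subsetI)
      fix k assume "k \<in> {..<min i CARD('n)}"
      then show "k \<in> rk ` {c :: 'n. rk c < i}"
        by (intro image_eqI[of _ _ "unrk k"]) auto
    qed (auto simp: rk_less)
  qed (auto intro: inj_onI)
  then show ?thesis by (simp add: bij_betw_same_card)
qed

lemma independent_columns:
  fixes g :: "((real,'n::finite) vec,'n) vec"
  assumes "det g \<noteq> 0"
  shows "independent (columns g)"
  using assms det_dependent_rows[of "transpose g"]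
  by (auto simp: det_transpose rows_transpose dependent_def vec.dependent_def span_vec_eq)

lemma is_flag_flag_of:
  fixes g :: "((real,'n::{finite,linorder}) vec,'n) vec"
  assumes "invertible g"
  shows "is_flag (flag_of g)"
  unfolding is_flag_def
proof (intro conjI allI)
  fix i
  have nz: "det g \<noteq> 0" using assms invertible_det_nz by blast
  have inj: "inj (\<lambda>c. column c g)"
    using nz det_identical_columns[of _ _ g] by (auto intro!: injI)
  have ind: "independent (columns g)"
    using nz by (rule independent_columns)
  define S where "S = (\<lambda>c. column c g) ` {c. rk c < i}"
  have S: "{column c g | c. rk c < i} = S" by (auto simp: S_def)
  have "independent S"
    using ind by (rule independent_mono) (auto simp: S_def columns_def)
  then have "dim S = card S" by (rule dim_eq_card_independent)
  also have "\<dots> = min i CARD('n)"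
    unfolding S_def using inj by (subst card_image) (auto intro: inj_on_subset simp: card_rk_less)
  finally show "dim (flag_of g i) = min i CARD('n)"
    by (simp add: flag_of_def S)
  show "subspace (flag_of g i)" by (simp add: flag_of_def)
  show "flag_of g i \<subseteq> flag_of g (Suc i)"
    unfolding flag_of_def by (rule span_mono) auto
qed

lemma flag_of_0: "flag_of g 0 = {0}"
  by (simp add: flag_of_def)

lemma flag_of_1:
  fixes g :: "((real,'n::{finite,linorder}) vec,'n) vec"
  shows "flag_of g 1 = span {column (unrk 0) g}"
proof -
  have "{column c g | c. rk c < 1} = {column (unrk 0) g}"
    by (auto simp: rk_eq_0_iff)
  then show ?thesis by (simp add: flag_of_def)
qed

lemma column_matrix_mult: "column c (g ** X) = g *v column c X"
  by (simp add: column_def matrix_matrix_mult_def matrix_vector_mult_def vec_eq_iff)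

lemma act_flag_of: "act g (flag_of X) = flag_of (g ** X)"
proof
  fix i
  have "(*v) g ` {column c X | c. rk c < i} = {column c (g ** X) | c. rk c < i}"
    by (auto simp: column_matrix_mult image_iff)
  then show "act g (flag_of X) i = flag_of (g ** X) i"
    unfolding act_def flag_of_def
    using linear_span_image[of "(*v) g" "{column c X | c. rk c < i}"] by (simp add: matrix_vector_mul_linear)
qed

section \<open>Half-spaces and the number of oriented lifts\<close>

definition half :: "'n::{finite,linorder} flag \<Rightarrow> nat \<Rightarrow> (real,'n) vec \<Rightarrow> (real,'n) vec set" where
  "half F i x = {u + t *\<^sub>R x | u t. u \<in> F (i - 1) \<and> t > 0}"

text \<open>Modulo \<open>F (i - 1)\<close> every vector of \<open>F i\<close> is a multiple of one
  fixed x, and the half-space of a vector depends only on the sign of that multiple.\<close>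

lemma card_halves:
  fixes F :: "'n::{finite,linorder} flag"
  assumes F: "is_flag F" and i: "1 \<le> i" "i \<le> CARD('n)"
  shows "card {H. is_half F i H} = 2"
proof -
  define G where "G = F (i - 1)"
  have half_G: "half F i x = {u + t *\<^sub>R x | u t. u \<in> G \<and> t > 0}" for x
    by (simp add: half_def G_def)
  have is_half_G: "is_half F i H \<longleftrightarrow> (\<exists>x\<in>F i - G. H = half F i x)" for H
    by (simp add: is_half_def half_def G_def)
  have sub: "subspace (G)" "subspace (F i)" and dims: "dim (G) = i - 1" "dim (F i) = i"
    using F i by (auto simp: is_flag_def G_def)
  have le: "G \<subseteq> F i"
    using F i unfolding is_flag_def G_def by (metis Suc_diff_1 less_eq_Suc_le One_nat_def)
  have "G \<noteq> F i" using dims i by auto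
  then obtain x where x: "x \<in> F i" "x \<notin> G" using le by auto
  have spanx: "span (G) = G" using sub by (simp add: span_eq_iff)
  have nx: "x \<notin> span (G)" using x(2) by (simp only: spanx not_False_eq_True)
  have "F i = span (insert x (G))"
  proof (rule subspace_dim_equal[symmetric])
    show "span (insert x (G)) \<subseteq> F i"
      using x le sub by (intro span_minimal) auto
    show "dim (F i) \<le> dim (span (insert x (G)))"
      using nx dims i by (simp add: dim_insert)
  qed (use sub in auto)
  then have dec: "\<exists>t. y - t *\<^sub>R x \<in> G" if "y \<in> F i" for y
    using that by (simp add: span_insert spanx)
  have resc_le: "half F i y \<subseteq> half F i z" if "y = u + t *\<^sub>R z" "t > 0" "u \<in> G" for y z u t
  proof
    fix v assume "v \<in> half F i y"
    then obtain w s where ws: "v = w + s *\<^sub>R y" "w \<in> G" "s > 0" by (auto simp: half_G)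
    have "v = (w + s *\<^sub>R u) + (s * t) *\<^sub>R z" by (simp add: ws that algebra_simps)
    moreover have "w + s *\<^sub>R u \<in> G"
      using sub(1) ws(2) that(3) by (simp add: subspace_add subspace_scale)
    moreover have "s * t > 0" using ws that by simp
    ultimately show "v \<in> half F i z" unfolding half_G by blast
  qed
  have resc: "half F i y = half F i z" if "y = u + t *\<^sub>R z" "t > 0" "u \<in> G" for y z u t
  proof
    show "half F i y \<subseteq> half F i z" using that by (rule resc_le)
    show "half F i z \<subseteq> half F i y"
    proof (rule resc_le)
      show "z = (- 1 / t) *\<^sub>R u + (1 / t) *\<^sub>R y" using that by (simp add: algebra_simps)
      show "1 / t > 0" "(- 1 / t) *\<^sub>R u \<in> G"
        using that subspace_scale[OF sub(1) that(3), of "- 1 / t"] by simp_all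
    qed
  qed
  have mem: "x \<in> half F i x" unfolding half_G
    using sub(1) subspace_0 by (intro CollectI exI[of _ 0] exI[of _ 1]) auto
  have "x \<notin> half F i (- x)"
  proof
    assume "x \<in> half F i (- x)"
    then obtain u t where ut: "x = u + t *\<^sub>R (- x)" "u \<in> G" "t > 0" by (auto simp: half_G)
    then have "(1 + t) *\<^sub>R x = u" by (simp add: algebra_simps)
    then have "x = (1 / (1 + t)) *\<^sub>R u" using ut(3) by auto
    then show False using x sub(1) ut(2) subspace_scale by metis
  qed
  then have ne: "half F i x \<noteq> half F i (- x)" using mem by auto
  have "{H. is_half F i H} = {half F i x, half F i (- x)}"
  proof (intro equalityI subsetI)
    fix H assume "H \<in> {H. is_half F i H}"
    then obtain y where y: "y \<in> F i" "y \<notin> G" and H: "H = half F i y"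
      by (auto simp: is_half_G)
    obtain t where t: "y - t *\<^sub>R x \<in> G" using dec y by blast
    have "t \<noteq> 0" using t y by auto
    then consider "t > 0" | "- t > 0" by linarith
    then show "H \<in> {half F i x, half F i (- x)}"
    proof cases
      case 1
      have "half F i y = half F i x" by (rule resc[OF _ 1 t]) simp
      then show ?thesis using H by simp
    next
      case 2
      have "half F i y = half F i (- x)" by (rule resc[OF _ 2 t]) simp
      then show ?thesis using H by simp
    qed
  next
    fix H assume "H \<in> {half F i x, half F i (- x)}"
    moreover have "- x \<in> F i" "- x \<notin> G"
      using x sub subspace_neg by (blast, metis minus_minus)
    ultimately show "H \<in> {H. is_half F i H}" using x by (auto simp: is_half_G)
  qed
  then show ?thesis using ne by simp
qed

lemma card_lifts:
  fixes F :: "'n::{finite,linorder} flag"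
  assumes F: "is_flag F"
  shows "card (lifts F) = 2 ^ CARD('n)"
proof -
  let ?P = "PiE {1..CARD('n)} (\<lambda>i. {H. is_half F i H})"
  \<comment> \<open>\<open>lifts\<close> takes the value {} outside the index range and
    \<open>PiE\<close> the value \<open>undefined\<close>, so the two sets are in bijection without
    being equal.\<close>
  have "bij_betw (\<lambda>H. restrict H {1..CARD('n)}) (lifts F) ?P"
  proof (rule bij_betwI[where g = "\<lambda>H i. if i \<in> {1..CARD('n)} then H i else {}"])
    show "(\<lambda>H i. if i \<in> {1..CARD('n)} then H i else {}) \<in> ?P \<rightarrow> lifts F"
      by (auto simp: lifts_def PiE_iff)
  qed (auto simp: lifts_def PiE_iff fun_eq_iff extensional_def)
  then have "card (lifts F) = card ?P" by (rule bij_betw_same_card)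
  also have "\<dots> = 2 ^ CARD('n)"
    by (subst card_PiE) (auto simp: card_halves[OF F])
  finally show ?thesis .
qed

text \<open>The number of summands equals the normalising denominator of \<open>cocA\<close>, so
  that \<open>cocA\<close> is an average of values of \<open>E\<close>.\<close>

lemma card_PiE_lifts:
  fixes Fs :: "nat \<Rightarrow> 'n::{finite,linorder} flag"
  assumes "\<And>i. i \<le> CARD('n) \<Longrightarrow> is_flag (Fs i)"
  shows "card (PiE {..CARD('n)} (\<lambda>i. lifts (Fs i))) = 2 ^ (CARD('n) * (CARD('n) + 1))"
proof -
  have "card (PiE {..CARD('n)} (\<lambda>i. lifts (Fs i))) = (\<Prod>i\<le>CARD('n). 2 ^ CARD('n))"
    by (subst card_PiE) (auto simp: card_lifts assms intro!: prod.cong)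
  then show ?thesis by (simp add: power_mult power_add)
qed

lemma abs_cocA_le_1:
  fixes Fs :: "nat \<Rightarrow> 'n::{finite,linorder} flag"
  assumes "\<And>i. i \<le> CARD('n) \<Longrightarrow> is_flag (Fs i)"
  shows "\<bar>cocA Fs\<bar> \<le> 1"
proof -
  have E: "\<bar>E X\<bar> \<le> 1" for X :: "nat \<Rightarrow> 'n flag \<times> 'n halves"
    unfolding E_def abs_prod
    by (rule prod_le_1) (auto simp: Or_def sgn_real_def)
  let ?P = "PiE {..CARD('n)} (\<lambda>i. lifts (Fs i))"
  have "\<bar>\<Sum>H\<in>?P. E (\<lambda>i. (Fs i, H i))\<bar> \<le> (\<Sum>H\<in>?P. \<bar>E (\<lambda>i. (Fs i, H i))\<bar>)"
    by (rule sum_abs)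
  also have "\<dots> \<le> of_nat (card ?P) * 1"
    by (rule sum_bounded_above) (rule E)
  also have "\<dots> = 2 ^ (CARD('n) * (CARD('n) + 1))"
    by (simp add: card_PiE_lifts assms)
  finally show ?thesis
    unfolding cocA_def by (simp add: abs_mult divide_simps)
qed

section \<open>Faces of a tuple and the cancellation of signs\<close>

definition skip :: "nat \<Rightarrow> nat \<Rightarrow> nat" where
  "skip i j = (if j < i then j else Suc j)"

lemma skip_list: "i \<le> n \<Longrightarrow> [0..<i] @ [Suc i..<Suc n] = map (skip i) [0..<n]"
  by (rule nth_equalityI) (auto simp: skip_def nth_append)

lemma skip_inj: "skip i a = skip i b \<longleftrightarrow> a = b"
  by (auto simp: skip_def split: if_splits)

lemma skip_neq: "skip i j \<noteq> i" by (auto simp: skip_def)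

lemma skip_less: "j < n \<Longrightarrow> skip i j < Suc n" by (auto simp: skip_def)

lemma skip_image: "i \<le> n \<Longrightarrow> skip i ` {..<n} = {..n} - {i}"
proof (intro equalityI subsetI)
  fix k assume i: "i \<le> n" and "k \<in> {..n} - {i}"
  then show "k \<in> skip i ` {..<n}"
    by (cases "k < i") (auto simp: skip_def image_iff intro: bexI[of _ k] bexI[of _ "k - 1"])
qed (auto simp: skip_def)

lemma prod_sgn: "sgn (\<Prod>i\<in>I. f i) = (\<Prod>i\<in>I. sgn (f i :: real))"
  by (induction I rule: infinite_finite_induct) (auto simp: sgn_mult)

text \<open>Each sign occurs once in every face that does not omit its index, hence n times in all,
  and n is even.\<close>

lemma prod_sgn_skip:
  fixes s :: "nat \<Rightarrow> real"
  assumes ev: "even n" and s: "\<And>i. i \<le> n \<Longrightarrow> s i \<noteq> 0"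
  shows "(\<Prod>i\<le>n. \<Prod>k<n. sgn (s (skip i k))) = 1"
proof -
  have "(\<Prod>i\<le>n. \<Prod>k<n. sgn (s (skip i k))) = (\<Prod>i\<le>n. \<Prod>j\<in>{..n} - {i}. sgn (s j))"
  proof (rule prod.cong[OF refl])
    fix i assume "i \<in> {..n}"
    then have "(\<Prod>j\<in>{..n} - {i}. sgn (s j)) = (\<Prod>j\<in>skip i ` {..<n}. sgn (s j))"
      by (simp add: skip_image)
    also have "\<dots> = (\<Prod>k<n. sgn (s (skip i k)))"
      by (subst prod.reindex) (auto simp: skip_inj intro: inj_onI)
    finally show "(\<Prod>k<n. sgn (s (skip i k))) = (\<Prod>j\<in>{..n} - {i}. sgn (s j))" by simp
  qed
  also have "\<dots> = (\<Prod>i\<le>n. (\<Prod>j\<le>n. sgn (s j)) * sgn (s i))"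
  proof (rule prod.cong[OF refl])
    fix i assume i: "i \<in> {..n}"
    have "(\<Prod>j\<le>n. sgn (s j)) * sgn (s i) = (sgn (s i) * sgn (s i)) * (\<Prod>j\<in>{..n} - {i}. sgn (s j))"
      using i by (simp add: prod.remove[of "{..n}" i] mult_ac)
    moreover have "sgn (s i) * sgn (s i) = 1" using s i by (auto simp: sgn_real_def)
    ultimately show "(\<Prod>j\<in>{..n} - {i}. sgn (s j)) = (\<Prod>j\<le>n. sgn (s j)) * sgn (s i)" by simp
  qed
  also have "\<dots> = (\<Prod>j\<le>n. sgn (s j)) ^ (n + 2)"
    by (simp add: prod.distrib)
  also have "\<dots> = 1"
  proof -
    have "\<bar>\<Prod>j\<le>n. sgn (s j)\<bar> = 1" using s by (simp add: abs_prod)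
    then show ?thesis using ev by (metis even_add even_numeral power_even_abs power_one)
  qed
  finally show ?thesis .
qed

definition cols :: "(nat \<Rightarrow> (real,'n) vec) \<Rightarrow> ((real,'n::{finite,linorder}) vec,'n) vec" where
  "cols w = (\<chi> r c. w (rk c) $ r)"

lemma column_cols: "column c (cols w) = w (rk c)"
  by (simp add: column_def cols_def vec_eq_iff)

lemma det_cols_scale:
  "det (cols (\<lambda>k. s k *\<^sub>R w k) :: ((real,'n::{finite,linorder}) vec,'n) vec)
    = (\<Prod>k<CARD('n). s k) * det (cols w :: ((real,'n) vec,'n) vec)"
proof -
  have "det (cols (\<lambda>k. s k *\<^sub>R w k) :: ((real,'n) vec,'n) vec)
      = det (\<chi> c. s (rk c) *s w (rk c) :: ((real,'n) vec,'n) vec)"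
    by (subst det_transpose[symmetric]) (simp add: transpose_def cols_def vector_scalar_mult_def)
  also have "\<dots> = (\<Prod>c\<in>(UNIV :: 'n set). s (rk c)) * det (\<chi> c. w (rk c) :: ((real,'n) vec,'n) vec)"
    by (rule det_rows_mul)
  also have "(\<Prod>c\<in>(UNIV :: 'n set). s (rk c)) = (\<Prod>k<CARD('n). s k)"
    using bij_betw_rk by (rule prod.reindex_bij_betw)
  also have "det (\<chi> c. w (rk c) :: ((real,'n) vec,'n) vec) = det (cols w :: ((real,'n) vec,'n) vec)"
    by (subst det_transpose[symmetric]) (simp add: transpose_def cols_def)
  finally show ?thesis .
qed

lemma cols_notin_span:
  assumes nz: "det (cols w :: ((real,'n::{finite,linorder}) vec,'n) vec) \<noteq> 0" and k: "k < CARD('n)"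
  shows "w k \<notin> span (w ` {..<k})"
proof
  assume *: "w k \<in> span (w ` {..<k})"
  let ?A = "cols w :: ((real,'n) vec,'n) vec"
  \<comment> \<open>Distinctness ensures that deleting \<open>w k\<close> from the set of columns
    leaves all earlier columns in it.\<close>
  have "w j \<noteq> w k" if "j < k" for j
    using that k nz det_identical_columns[of "unrk j" "unrk k" ?A]
    by (auto simp: column_cols) (metis less_trans nat_neq_iff rk_unrk)
  then have "w ` {..<k} \<subseteq> columns ?A - {w k}"
    using k by (auto simp: columns_def column_cols image_iff) (metis less_trans rk_unrk)
  then have "w k \<in> span (columns ?A - {w k})" using * span_mono by blast
  moreover have "w k \<in> columns ?A"
    using k by (auto simp: columns_def column_cols) (metis rk_unrk)
  ultimately show False
    using independent_columns[OF nz] by (auto simp: dependent_def)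
qed

text \<open>For flags with linearly independent lines every bracket step uses \<open>d = 1\<close>.\<close>
lemma br_generic:
  assumes "\<And>k. k < length FHs \<Longrightarrow> fst (FHs ! k) 0 = {0} \<and> w k \<in> fst (FHs ! k) 1 \<and>
      (SOME x. x \<in> snd (FHs ! k) 1) = w k \<and> w k \<notin> span (w ` {..<k})"
  shows "br FHs = map w [0..<length FHs]"
  using assms
proof (induction FHs rule: rev_induct)
  case Nil
  then show ?case by (simp add: br_def)
next
  case (snoc FH FHs)
  have IH: "br FHs = map w [0..<length FHs]"
  proof (rule snoc.IH)
    fix k assume k: "k < length FHs"
    then have "(FHs @ [FH]) ! k = FHs ! k" by (simp add: nth_append)
    then show "fst (FHs ! k) 0 = {0} \<and> w k \<in> fst (FHs ! k) 1 \<and>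
        (SOME x. x \<in> snd (FHs ! k) 1) = w k \<and> w k \<notin> span (w ` {..<k})"
      using snoc.prems[of k] k by simp
  qed
  have 1: "fst FH 0 = {0}" "w (length FHs) \<in> fst FH 1" "(SOME x. x \<in> snd FH 1) = w (length FHs)"
     "w (length FHs) \<notin> span (w ` {..<length FHs})"
    using snoc.prems[of "length FHs"] by auto
  have "(LEAST d. \<not> fst FH d \<subseteq> span (set (br FHs))) = 1"
  proof (rule Least_equality)
    show "\<not> fst FH 1 \<subseteq> span (set (br FHs))"
      using 1 by (auto simp: IH atLeast0LessThan)
    fix d assume "\<not> fst FH d \<subseteq> span (set (br FHs))"
    then show "1 \<le> d" using 1(1) span_0 by (cases d) auto
  qed
  then have "brstep (br FHs) FH = br FHs @ [w (length FHs)]"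
    using 1(3) by (simp add: brstep_def)
  then show ?case using IH by (simp add: br_def)
qed

text \<open>A lift replaces the vector spanning the line of flag i by a nonzero multiple. The signs
  of these multiples cancel over all faces by \<open>prod_sgn_skip\<close>, so \<open>E\<close>
  takes the same value on every lift and the average is this value.\<close>

lemma cocA_generic:
  fixes gs :: "nat \<Rightarrow> ((real,'n::{finite,linorder}) vec,'n) vec"
  assumes ev: "even CARD('n)"
    and inv: "\<And>i. i \<le> CARD('n) \<Longrightarrow> invertible (gs i)"
    and nz: "\<And>i. i \<le> CARD('n) \<Longrightarrow> det (cols (\<lambda>k. column (unrk 0) (gs (skip i k))) :: ((real,'n) vec,'n) vec) \<noteq> 0"
    and Fs: "\<And>i. i \<le> CARD('n) \<Longrightarrow> Fs i = flag_of (gs i)"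
  shows "cocA Fs = (\<Prod>i\<le>CARD('n). sgn (det (cols (\<lambda>k. column (unrk 0) (gs (skip i k))) :: ((real,'n) vec,'n) vec)))"
    (is "_ = ?P")
proof -
  let ?n = "CARD('n)"
  let ?a = "\<lambda>i. column (unrk 0) (gs i)"
  have E: "E (\<lambda>i. (Fs i, H i)) = ?P" if H: "H \<in> PiE {..?n} (\<lambda>i. lifts (Fs i))" for H
  proof -
    \<comment> \<open>This is the vector that \<open>brstep\<close> appends for flag i when d = 1;
      the higher half-spaces of the lift never enter.\<close>
    define y where "y i = (SOME x. x \<in> H i 1)" for i
    have "\<exists>s. s \<noteq> 0 \<and> y i = s *\<^sub>R ?a i" if i: "i \<le> ?n" for i
    proof -
      have "H i \<in> lifts (flag_of (gs i))" using H i Fs by (auto simp: PiE_iff)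
      then have "is_half (flag_of (gs i)) 1 (H i 1)" by (auto simp: lifts_def Suc_le_eq)
      then obtain x where x: "x \<in> span {?a i}" "x \<noteq> 0" and
        Hi: "H i 1 = {u + t *\<^sub>R x | u t. u \<in> {0} \<and> t > 0}"
        using flag_of_1[of "gs i"] flag_of_0[of "gs i"] unfolding is_half_def by auto
      from x obtain r where r: "x = r *\<^sub>R ?a i" by (auto simp: span_singleton)
      have "x \<in> H i 1" unfolding Hi by (intro CollectI exI[of _ 0] exI[of _ 1]) auto
      then have "y i \<in> H i 1" unfolding y_def by (rule someI)
      then obtain t where "t > 0" "y i = t *\<^sub>R x" unfolding Hi by auto
      then show ?thesis using r x by (intro exI[of _ "t * r"]) auto
    qed
    then obtain s where s: "\<And>i. i \<le> ?n \<Longrightarrow> s i \<noteq> 0 \<and> y i = s i *\<^sub>R ?a i" by metis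
    have Or_eq: "Or (br (map (\<lambda>i. (Fs i, H i)) ([0..<i] @ [Suc i..<Suc ?n])))
        = (\<Prod>k<?n. sgn (s (skip i k))) * sgn (det (cols (\<lambda>k. ?a (skip i k)) :: ((real,'n) vec,'n) vec))"
      if i: "i \<le> ?n" for i
    proof -
      define w where "w k = y (skip i k)" for k
      have le: "skip i k \<le> ?n" if "k < ?n" for k using skip_less[OF that, of i] by simp
      have "cols w = (cols (\<lambda>k. s (skip i k) *\<^sub>R ?a (skip i k)) :: ((real,'n) vec,'n) vec)"
        unfolding cols_def w_def by (simp add: vec_eq_iff s le rk_less)
      then have det_w: "det (cols w :: ((real,'n) vec,'n) vec)
         = (\<Prod>k<?n. s (skip i k)) * det (cols (\<lambda>k. ?a (skip i k)) :: ((real,'n) vec,'n) vec)"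
        by (simp add: det_cols_scale)
      have "det (cols w :: ((real,'n) vec,'n) vec) \<noteq> 0"
        using nz[OF i] by (simp add: det_w s le)
      note ns = cols_notin_span[OF this]
      have "br (map (\<lambda>i. (Fs i, H i)) ([0..<i] @ [Suc i..<Suc ?n])) = map w [0..<?n]"
      proof -
        have "br (map (\<lambda>i. (Fs i, H i)) (map (skip i) [0..<?n]))
            = map w [0..<length (map (\<lambda>i. (Fs i, H i)) (map (skip i) [0..<?n]))]"
        proof (rule br_generic)
          fix k assume "k < length (map (\<lambda>i. (Fs i, H i)) (map (skip i) [0..<?n]))"
          then have k: "k < ?n" by simp
          have nth: "map (\<lambda>i. (Fs i, H i)) (map (skip i) [0..<?n]) ! k = (flag_of (gs (skip i k)), H (skip i k))"
            using k by (simp add: Fs le)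
          have "w k \<in> flag_of (gs (skip i k)) 1"
            unfolding flag_of_1 w_def using s[OF le[OF k]] by (simp add: span_base span_scale)
          then show "fst (map (\<lambda>i. (Fs i, H i)) (map (skip i) [0..<?n]) ! k) 0 = {0} \<and>
            w k \<in> fst (map (\<lambda>i. (Fs i, H i)) (map (skip i) [0..<?n]) ! k) 1 \<and>
            (SOME x. x \<in> snd (map (\<lambda>i. (Fs i, H i)) (map (skip i) [0..<?n]) ! k) 1) = w k \<and>
            w k \<notin> span (w ` {..<k})"
            unfolding nth using ns[OF k] by (simp add: flag_of_0 w_def y_def)
        qed
        then show ?thesis using i by (simp only: skip_list) simp
      qed
      moreover have "Or (map w [0..<?n]) = sgn (det (cols w :: ((real,'n) vec,'n) vec))"
        by (simp add: Or_def cols_def rk_less)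
      ultimately show ?thesis by (simp add: det_w sgn_mult prod_sgn)
    qed
    have "(\<Prod>i\<le>?n. \<Prod>k<?n. sgn (s (skip i k))) = 1"
      using ev s by (intro prod_sgn_skip) auto
    then show ?thesis unfolding E_def using Or_eq by (simp add: prod.distrib)
  qed
  have "cocA Fs = (1 / 2 ^ (?n * (?n + 1))) * (of_nat (card (PiE {..?n} (\<lambda>i. lifts (Fs i)))) * ?P)"
    unfolding cocA_def using E by simp
  also have "\<dots> = ?P"
    using is_flag_flag_of[OF inv] Fs by (subst card_PiE_lifts) auto
  finally show ?thesis .
qed

section \<open>The cyclic flags and their reflections\<close>

lemma tendsto_det:
  fixes A :: "'a \<Rightarrow> ((real,'n::finite) vec,'n) vec"
  assumes "(A \<longlongrightarrow> B) F"
  shows "((\<lambda>x. det (A x)) \<longlongrightarrow> det B) F"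
  unfolding det_def using assms
  by (intro tendsto_sum tendsto_mult tendsto_const tendsto_prod tendsto_vec_nth)

lemma tendsto_matrix_mult:
  fixes A :: "'a \<Rightarrow> ((real,'n::finite) vec,'n) vec"
  assumes "(A \<longlongrightarrow> A') F" "(B \<longlongrightarrow> B') F"
  shows "((\<lambda>x. A x ** B x) \<longlongrightarrow> A' ** B') F"
  unfolding matrix_matrix_mult_def using assms
  by (intro tendsto_vec_lambda tendsto_sum tendsto_mult tendsto_vec_nth)

section \<open>The vertices and their frames\<close>

lemma eq_of_mod_eq:
  fixes a b N :: nat
  assumes "a mod N = b mod N" "a \<le> b" "b < a + N"
  shows "a = b"
proof -
  have "N dvd b - a" using assms by (metis mod_eq_dvd_iff_nat)
  then show ?thesis using assms dvd_imp_le[of N "b - a"] by (cases "a < b") auto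
qed

text \<open>The standard basis followed by minus its sum, repeated with period n + 1: the vertices
  of a simplex centred at the origin, any n of them linearly independent.\<close>

definition vtx :: "nat \<Rightarrow> (real,'n::{finite,linorder}) vec" where
  "vtx l = (let m = l mod Suc CARD('n) in if m < CARD('n) then axis (unrk m) 1 else (\<chi> _. - 1))"

text \<open>Coefficients with respect to all n + 1 vertices are determined only up to a common
  constant; this choice makes the last one zero.\<close>

definition coord :: "nat \<Rightarrow> (real,'n::{finite,linorder}) vec \<Rightarrow> real" where
  "coord l x = (let m = l mod Suc CARD('n) in if m < CARD('n) then x $ unrk m else 0)"

lemma unrk_eq_iff: "a < CARD('n) \<Longrightarrow> b < CARD('n) \<Longrightarrow> (unrk a :: 'n::{finite,linorder}) = unrk b \<longleftrightarrow> a = b"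
  by (metis rk_unrk)

text \<open>The vertices sum to zero, so only differences of coordinates treat them symmetrically.\<close>
definition cdiff :: "nat \<Rightarrow> nat \<Rightarrow> (real,'n::{finite,linorder}) vec \<Rightarrow> real" where
  "cdiff a b x = coord a x - coord b x"

lemma linear_cdiff: "linear (cdiff a b :: (real,'n::{finite,linorder}) vec \<Rightarrow> real)"
  by (auto simp: linear_iff cdiff_def coord_def Let_def algebra_simps)

lemma cdiff_vtx:
  "cdiff a b (vtx m :: (real,'n::{finite,linorder}) vec)
    = of_bool (a mod Suc CARD('n) = m mod Suc CARD('n)) - of_bool (b mod Suc CARD('n) = m mod Suc CARD('n))"
proof -
  \<comment> \<open>The second term comes from the entries - 1 of the last vertex. It does not
    depend on a and therefore cancels in \<open>cdiff\<close>.\<close>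
  have "coord a (vtx m :: (real,'n) vec)
      = of_bool (a mod Suc CARD('n) = m mod Suc CARD('n)) - of_bool (m mod Suc CARD('n) = CARD('n))" for a
  proof -
    have "m mod Suc CARD('n) < Suc CARD('n)" "a mod Suc CARD('n) < Suc CARD('n)" by simp_all
    then show ?thesis
      by (auto simp: coord_def vtx_def Let_def axis_def unrk_eq_iff less_Suc_eq)
  qed
  then show ?thesis by (simp add: cdiff_def)
qed

lemma vtx_mod_cong: "a mod Suc CARD('n) = b mod Suc CARD('n) \<Longrightarrow> (vtx a :: (real,'n::{finite,linorder}) vec) = vtx b"
  by (simp add: vtx_def)

text \<open>Here p is the vertex missing among the columns. The functionals
  \<open>cdiff (m c) p\<close> are dual to the vertices \<open>m c\<close> and read off the
  coefficients of a vector in the kernel.\<close>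

lemma invertible_vtx_matrix:
  fixes m :: "'n::{finite,linorder} \<Rightarrow> nat"
  assumes p: "\<And>c. m c mod Suc CARD('n) \<noteq> p mod Suc CARD('n)"
    and inj: "\<And>c c'. m c mod Suc CARD('n) = m c' mod Suc CARD('n) \<Longrightarrow> c = c'"
    and s: "\<And>c. s c \<noteq> 0"
  shows "invertible (\<chi> r c. s c * vtx (m c) $ r :: ((real,'n) vec,'n) vec)" (is "invertible ?A")
proof -
  have "x = 0" if "?A *v x = 0" for x
  proof -
    have Ax: "?A *v x = (\<Sum>c\<in>UNIV. (x $ c * s c) *\<^sub>R vtx (m c))"
      by (simp add: vec_eq_iff matrix_vector_mult_def sum_component mult_ac)
    have "x $ c = 0" for c
    proof -
      let ?D = "cdiff (m c) p :: (real,'n) vec \<Rightarrow> real"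
      have "?D (?A *v x) = (\<Sum>c'\<in>UNIV. (x $ c' * s c') * ?D (vtx (m c')))"
        unfolding Ax by (simp add: linear_sum[OF linear_cdiff] linear_cmul[OF linear_cdiff])
      also have "\<dots> = (\<Sum>c'\<in>UNIV. if c' = c then x $ c * s c else 0)"
        using inj p by (intro sum.cong) (auto simp: cdiff_vtx p[symmetric])
      also have "\<dots> = x $ c * s c" by simp
      finally show ?thesis
        using that s by (simp add: linear_0[OF linear_cdiff])
    qed
    then show ?thesis by (simp add: vec_eq_iff)
  qed
  then have "\<exists>B. B ** ?A = mat 1" by (simp add: matrix_left_invertible_ker)
  then show ?thesis by (simp add: invertible_left_inverse)
qed

text \<open>Adding the period n + 1 keeps the subtraction of natural numbers from being truncated.
  The columns run backwards from vertex j, and vertex j + 1 is the one left out.\<close>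

definition frame :: "real \<Rightarrow> nat \<Rightarrow> ((real,'n::{finite,linorder}) vec,'n) vec" where
  "frame h j = (\<chi> r c. h ^ rk c * vtx (j + Suc CARD('n) - rk c) $ r)"

lemma invertible_frame:
  assumes "h \<noteq> 0"
  shows "invertible (frame h j :: ((real,'n::{finite,linorder}) vec,'n) vec)"
  unfolding frame_def
\<comment> \<open>The n columns use n consecutive residues ending in j, so the missing one is j +
  1.\<close>
proof (rule invertible_vtx_matrix[where p = "Suc j"])
  fix c :: 'n
  show "(j + Suc CARD('n) - rk c) mod Suc CARD('n) \<noteq> Suc j mod Suc CARD('n)"
  proof
    assume "(j + Suc CARD('n) - rk c) mod Suc CARD('n) = Suc j mod Suc CARD('n)"
    from eq_of_mod_eq[OF this[symmetric]] rk_less[of c] show False by linarith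
  qed
  fix c' :: 'n
  assume "(j + Suc CARD('n) - rk c) mod Suc CARD('n) = (j + Suc CARD('n) - rk c') mod Suc CARD('n)"
  then have "j + Suc CARD('n) - rk c = j + Suc CARD('n) - rk c'"
    using eq_of_mod_eq[of "j + Suc CARD('n) - rk c" "Suc CARD('n)" "j + Suc CARD('n) - rk c'"]
      eq_of_mod_eq[of "j + Suc CARD('n) - rk c'" "Suc CARD('n)" "j + Suc CARD('n) - rk c"]
      rk_less[of c] rk_less[of c'] by linarith
  then have "rk c = rk c'" using rk_less[of c] rk_less[of c'] by linarith
  then show "c = c'" by simp
qed (use assms in auto)

lemma column_frame: "column c (frame h j :: ((real,'n::{finite,linorder}) vec,'n) vec)
    = h ^ rk c *\<^sub>R vtx (j + Suc CARD('n) - rk c)"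
  by (simp add: column_def frame_def vec_eq_iff)

text \<open>Besides negating vertex i + 1 it sends vertex i to the sum of vertex i and twice vertex
  i + 1, as it must because the vertices sum to zero and the others are fixed.\<close>

definition reflection :: "nat \<Rightarrow> ((real,'n::{finite,linorder}) vec,'n) vec" where
  "reflection i = matrix (\<lambda>x. x - (2 * cdiff (Suc i) i x) *\<^sub>R vtx (Suc i))"

lemma reflection_mult: "reflection i *v (x :: (real,'n::{finite,linorder}) vec) = x - (2 * cdiff (Suc i) i x) *\<^sub>R vtx (Suc i)"
proof -
  have "linear (\<lambda>x. x - (2 * cdiff (Suc i) i x) *\<^sub>R vtx (Suc i) :: (real,'n) vec)"
    by (simp add: linear_iff linear_add[OF linear_cdiff] linear_cmul[OF linear_cdiff] algebra_simps)
  from matrix_vector_mul(2)[OF this] show ?thesis unfolding reflection_def by (rule fun_cong)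
qed

lemma Suc_mod_neq: "N > 1 \<Longrightarrow> Suc i mod N \<noteq> i mod N"
  using eq_of_mod_eq[of i N "Suc i"] by auto

lemma reflection_invol: "reflection i ** reflection i = (mat 1 :: ((real,'n::{finite,linorder}) vec,'n) vec)"
proof -
  have "reflection i *v (reflection i *v x) = x" for x :: "(real,'n) vec"
  proof -
    let ?\<phi> = "cdiff (Suc i) i :: (real,'n) vec \<Rightarrow> real"
    let ?u = "vtx (Suc i) :: (real,'n) vec"
    note lin = linear_cdiff[of "Suc i" i, where 'n='n]
    have u: "?\<phi> ?u = 1" using Suc_mod_neq[of "Suc CARD('n)" i] by (simp add: cdiff_vtx)
    have "?\<phi> (x - (2 * ?\<phi> x) *\<^sub>R ?u) = - ?\<phi> x"
      using linear_diff[OF lin, of x "(2 * ?\<phi> x) *\<^sub>R ?u"] linear_cmul[OF lin, of "2 * ?\<phi> x" ?u] u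
      by simp
    then show ?thesis by (simp add: reflection_mult)
  qed
  then show ?thesis by (simp add: matrix_eq matrix_vector_mul_assoc)
qed

text \<open>The limit of the reflection in the basis \<open>frame h j\<close> as h tends to 0: the
  entry - 1 sits at vertex i + 1.\<close>

definition signs :: "nat \<Rightarrow> nat \<Rightarrow> ((real,'n::{finite,linorder}) vec,'n) vec" where
  "signs i j = (\<chi> r c. if r = c then
      (if (j + Suc CARD('n) - rk c) mod Suc CARD('n) = Suc i mod Suc CARD('n) then - 1 else 1) else 0)"

text \<open>The column is that of vertex i, the row that of its predecessor in the frame, vertex i +
  1. The matrix is zero if vertex i comes first in the frame or is the one left out.\<close>

definition shear :: "nat \<Rightarrow> nat \<Rightarrow> ((real,'n::{finite,linorder}) vec,'n) vec" where
  "shear i j = (\<chi> r c. if (j + Suc CARD('n) - rk c) mod Suc CARD('n) = i mod Suc CARD('n)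
      \<and> rk c = Suc (rk r) then 1 else 0)"

definition frame_reflection :: "real \<Rightarrow> nat \<Rightarrow> nat \<Rightarrow> ((real,'n::{finite,linorder}) vec,'n) vec" where
  "frame_reflection h i j = signs i j + (2 * h) *\<^sub>R shear i j"

text \<open>Along the flag \<open>j\<close> the vertex \<open>i + 1\<close> comes immediately before the vertex \<open>i\<close>, so in the
  basis of \<^term>\<open>frame h j\<close> the reflection is triangular, and its off-diagonal entry scales with \<open>h\<close>.\<close>
lemma reflection_frame:
  assumes ij: "i mod Suc CARD('n) \<noteq> j mod Suc CARD('n)"
  shows "reflection i ** frame h j = frame h j ** (frame_reflection h i j :: ((real,'n::{finite,linorder}) vec,'n) vec)"
proof -
  let ?N = "Suc CARD('n)"
  let ?L = "frame h j :: ((real,'n) vec,'n) vec"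
  have "reflection i *v column c ?L = ?L *v column c (frame_reflection h i j)" for c :: 'n
  proof -
    let ?m = "j + ?N - rk c"
    have split: "?L *v column c (frame_reflection h i j) = (\<Sum>r\<in>UNIV. signs i j $ r $ c *\<^sub>R column r ?L)
        + (2 * h) *\<^sub>R (\<Sum>r\<in>UNIV. shear i j $ r $ c *\<^sub>R column r ?L)"
      by (simp add: matrix_mult_sum frame_reflection_def column_def scalar_mult_eq_scaleR
          scaleR_add_left sum.distrib scaleR_sum_right)
    have S: "(\<Sum>r\<in>UNIV. (signs i j :: ((real,'n) vec,'n) vec) $ r $ c *\<^sub>R column r ?L)
        = (if ?m mod ?N = Suc i mod ?N then - 1 else 1) *\<^sub>R column c ?L"
    proof -
      have "(\<Sum>r\<in>UNIV. (signs i j :: ((real,'n) vec,'n) vec) $ r $ c *\<^sub>R column r ?L)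
        = (\<Sum>r\<in>UNIV. if r = c then (if ?m mod ?N = Suc i mod ?N then - 1 else 1) *\<^sub>R column c ?L else 0)"
        by (intro sum.cong) (auto simp: signs_def)
      then show ?thesis by simp
    qed
    have T: "(2 * h) *\<^sub>R (\<Sum>r\<in>UNIV. (shear i j :: ((real,'n) vec,'n) vec) $ r $ c *\<^sub>R column r ?L)
        = (if ?m mod ?N = i mod ?N then (2 * h ^ rk c) *\<^sub>R vtx (Suc i) else 0)"
    proof (cases "?m mod ?N = i mod ?N")
      case False
      then show ?thesis by (simp add: shear_def)
    next
      case True
      \<comment> \<open>As i and j differ modulo n + 1, vertex i is not the first vector of the
        frame and has a predecessor there.\<close>
      have "rk c \<noteq> 0"
      proof
        assume "rk c = 0"
        then have "?m mod ?N = j mod ?N" by (metis diff_zero mod_add_self2)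
        then show False using True ij by simp
      qed
      then obtain k where k: "rk c = Suc k" by (cases "rk c") auto
      have kn: "k < CARD('n)" using k rk_less[of c] by simp
      \<comment> \<open>Column q carries vertex i + 1 with weight \<open>h ^ k\<close>; the missing
        power of h is supplied by the coefficient 2 h of \<open>shear\<close>.\<close>
      define q where "q = (unrk k :: 'n)"
      have q: "rk q = k" using kn by (simp add: q_def)
      have "(\<Sum>r\<in>UNIV. (shear i j :: ((real,'n) vec,'n) vec) $ r $ c *\<^sub>R column r ?L)
        = (\<Sum>r\<in>UNIV. if r = q then column q ?L else 0)"
        using True k by (intro sum.cong) (auto simp: shear_def q[symmetric])
      also have "\<dots> = h ^ k *\<^sub>R vtx (j + ?N - k)" by (simp add: column_frame q)
      also have "vtx (j + ?N - k) = (vtx (Suc i) :: (real,'n) vec)"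
      proof (rule vtx_mod_cong)
        have "j + ?N - k = Suc ?m" using k kn by simp
        then show "(j + ?N - k) mod ?N = Suc i mod ?N" using True by (metis mod_Suc_eq)
      qed
      finally show ?thesis using True k by simp
    qed
    have "reflection i *v column c ?L = h ^ rk c *\<^sub>R (reflection i *v vtx ?m)"
      by (simp add: column_frame matrix_vector_mult_scaleR)
    also have "reflection i *v vtx ?m = (vtx ?m :: (real,'n) vec)
        - (2 * (of_bool (?m mod ?N = Suc i mod ?N) - of_bool (?m mod ?N = i mod ?N))) *\<^sub>R vtx (Suc i)"
      by (simp add: reflection_mult cdiff_vtx eq_commute)
    finally have R: "reflection i *v column c ?L = h ^ rk c *\<^sub>R (vtx ?m
        - (2 * (of_bool (?m mod ?N = Suc i mod ?N) - of_bool (?m mod ?N = i mod ?N))) *\<^sub>R vtx (Suc i))" .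
    have ne: "Suc i mod ?N \<noteq> i mod ?N" by (rule Suc_mod_neq) simp
    show ?thesis
    proof (cases "?m mod ?N = Suc i mod ?N")
      case True
      then have "vtx ?m = (vtx (Suc i) :: (real,'n) vec)" by (rule vtx_mod_cong)
      then show ?thesis
        unfolding split S T R unfolding column_frame using True ne by (simp add: vec_eq_iff algebra_simps)
    next
      case False
      then show ?thesis
        unfolding split S T R unfolding column_frame by (simp add: vec_eq_iff algebra_simps)
    qed
  qed
  then have "column c (reflection i ** ?L) = column c (?L ** frame_reflection h i j)" for c :: 'n
    by (simp add: column_matrix_mult)
  then show ?thesis by (simp add: column_def vec_eq_iff)
qed

text \<open>For nonzero h this matrix is conjugate, by the frame, to the involution
  \<open>reflection i\<close>.\<close>

lemma frame_reflection_invol: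
  assumes ij: "i mod Suc CARD('n) \<noteq> j mod Suc CARD('n)" and h: "h \<noteq> 0"
  shows "frame_reflection h i j ** frame_reflection h i j = (mat 1 :: ((real,'n::{finite,linorder}) vec,'n) vec)"
proof -
  let ?L = "frame h j :: ((real,'n) vec,'n) vec"
  obtain B where B: "B ** ?L = mat 1" using invertible_frame[OF h] by (auto simp: invertible_def)
  have "?L ** (frame_reflection h i j ** frame_reflection h i j) = reflection i ** reflection i ** ?L"
    by (metis matrix_mul_assoc reflection_frame[OF ij])
  then have "B ** ?L ** (frame_reflection h i j ** frame_reflection h i j) = B ** ?L"
    by (simp add: reflection_invol flip: matrix_mul_assoc)
  then show ?thesis by (simp add: B)
qed

text \<open>The frame of index i + n leaves out vertex i and ends with vertex i + 1. In this basis
  the shear vanishes and the reflection is diagonal with a single entry - 1.\<close>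

lemma det_reflection: "det (reflection i :: ((real,'n::{finite,linorder}) vec,'n) vec) = - 1"
proof -
  let ?N = "Suc CARD('n)"
  define j where "j = i + CARD('n)"
  let ?L = "frame 1 j :: ((real,'n) vec,'n) vec"
  have ij: "i mod ?N \<noteq> j mod ?N"
    using eq_of_mod_eq[of i ?N j] by (auto simp: j_def)
  have m: "(j + ?N - rk c) mod ?N = (Suc i + (CARD('n) - 1 - rk c)) mod ?N" for c :: 'n
  proof -
    have "j + ?N - rk c = Suc i + (CARD('n) - 1 - rk c) + ?N" using rk_less[of c] by (simp add: j_def)
    then show ?thesis by (simp only: mod_add_self2)
  qed
  have 1: "(j + ?N - rk c) mod ?N \<noteq> i mod ?N" for c :: 'n
    unfolding m using eq_of_mod_eq[of i ?N "Suc i + (CARD('n) - 1 - rk c)"] by auto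
  have 2: "(j + ?N - rk c) mod ?N = Suc i mod ?N \<longleftrightarrow> c = unrk (CARD('n) - 1)" for c :: 'n
  proof -
    define e where "e = CARD('n) - 1 - rk c"
    have "e < ?N" by (simp add: e_def)
    then have "e = 0" if "(Suc i + e) mod ?N = Suc i mod ?N"
      using eq_of_mod_eq[OF that[symmetric]] by linarith
    then have "(j + ?N - rk c) mod ?N = Suc i mod ?N \<longleftrightarrow> CARD('n) - 1 - rk c = 0"
      unfolding m e_def[symmetric] by (cases "e = 0") auto
    also have "\<dots> \<longleftrightarrow> rk c = CARD('n) - 1" using rk_less[of c] by linarith
    also have "\<dots> \<longleftrightarrow> c = unrk (CARD('n) - 1)" by (metis rk_unrk unrk_rk diff_less zero_less_card_finite zero_less_one)
    finally show ?thesis .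
  qed
  have "shear i j = (0 :: ((real,'n) vec,'n) vec)" using 1 by (simp add: shear_def vec_eq_iff)
  then have "reflection i ** ?L = ?L ** signs i j" using reflection_frame[OF ij, of 1] by (simp add: frame_reflection_def)
  then have "det (reflection i :: ((real,'n) vec,'n) vec) * det ?L = det ?L * det (signs i j :: ((real,'n) vec,'n) vec)"
    by (metis det_mul)
  moreover have "det ?L \<noteq> 0" using invertible_frame[of 1 j] by (simp add: invertible_det_nz)
  moreover have "det (signs i j :: ((real,'n) vec,'n) vec) = (\<Prod>c\<in>(UNIV :: 'n set). signs i j $ c $ c)"
    by (rule det_diagonal) (simp add: signs_def)
  moreover have "\<dots> = (\<Prod>c\<in>(UNIV :: 'n set). if c = unrk (CARD('n) - 1) then - 1 else 1)"
    by (intro prod.cong refl) (simp only: signs_def vec_lambda_beta 2 if_True simp_thms)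
  ultimately have "det (reflection i :: ((real,'n) vec,'n) vec) * det ?L = - 1 * det ?L" "det ?L \<noteq> 0"
    by simp_all
  then show ?thesis by (metis mult_right_cancel)
qed

lemma frame_reflection_tendsto: "((\<lambda>h. frame_reflection h i j ** X) \<longlongrightarrow> signs i j ** X) (at 0)"
proof -
  have "((\<lambda>h. frame_reflection h i j) \<longlongrightarrow> signs i j + (2 * 0) *\<^sub>R shear i j) (at 0)"
    unfolding frame_reflection_def by (intro tendsto_intros)
  then show ?thesis by (intro tendsto_matrix_mult) auto
qed

text \<open>The norm bound gives finite measure, the determinant gives flags, and the corner entry
  keeps the first column of \<open>frame h j ** X\<close> from degenerating to zero as h tends to 0.
  All three conditions are open and invariant under sign changes of the rows.\<close>

definition seeds :: "((real,'n::{finite,linorder}) vec,'n) vec set" where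
  "seeds = {X. norm X < 1 \<and> det X \<noteq> 0 \<and> X $ unrk 0 $ unrk 0 \<noteq> 0}"

lemma open_seeds: "open (seeds :: ((real,'n::{finite,linorder}) vec,'n) vec set)"
proof -
  have c1: "continuous_on UNIV (det :: ((real,'n) vec,'n) vec \<Rightarrow> real)"
    by (simp add: continuous_on_def tendsto_det)
  have "open {X :: ((real,'n) vec,'n) vec. norm X < 1}"
    by (intro open_Collect_less continuous_intros)
  moreover have "open {X :: ((real,'n) vec,'n) vec. det X \<noteq> 0}"
    by (intro open_Collect_neq c1 continuous_intros)
  moreover have "open {X :: ((real,'n) vec,'n) vec. X $ unrk 0 $ unrk 0 \<noteq> 0}"
    by (intro open_Collect_neq continuous_intros)
  ultimately show ?thesis unfolding seeds_def by (intro open_Collect_conj)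
qed

lemma seeds_nonempty: "(seeds :: ((real,'n::{finite,linorder}) vec,'n) vec set) \<noteq> {}"
proof -
  define a where "a = 1 / (1 + norm (mat 1 :: ((real,'n) vec,'n) vec))"
  have a: "a > 0" by (simp add: a_def add_pos_nonneg)
  let ?X = "a *\<^sub>R mat 1 :: ((real,'n) vec,'n) vec"
  have "norm ?X < 1" using a by (simp add: a_def divide_simps add_pos_nonneg)
  moreover have "det ?X \<noteq> 0" using a by (subst det_diagonal) (auto simp: mat_def)
  moreover have "?X $ unrk 0 $ unrk 0 \<noteq> 0" using a by (simp add: mat_def)
  ultimately have "?X \<in> seeds" unfolding seeds_def by blast
  then show ?thesis by blast
qed

lemma signs_seeds:
  fixes X :: "((real,'n::{finite,linorder}) vec,'n) vec"
  shows "signs i j ** X \<in> seeds \<longleftrightarrow> X \<in> seeds"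
proof -
  let ?s = "\<lambda>c. (signs i j :: ((real,'n) vec,'n) vec) $ c $ c"
  have abs: "\<bar>?s c\<bar> = 1" for c by (simp add: signs_def)
  have ent: "(signs i j ** X) $ r = ?s r *\<^sub>R X $ r" for r
  proof -
    have "(signs i j ** X) $ r $ c = (\<Sum>k\<in>UNIV. if k = r then ?s r * X $ r $ c else 0)" for c
      unfolding matrix_matrix_mult_def vec_lambda_beta by (rule sum.cong) (auto simp: signs_def)
    then show ?thesis by (simp add: vec_eq_iff)
  qed
  have "norm (signs i j ** X) = norm X"
    unfolding norm_vec_def[of "signs i j ** X"] norm_vec_def[of X] by (simp add: ent abs)
  moreover have "det (signs i j ** X) = 0 \<longleftrightarrow> det X = 0"
    using abs by (subst det_mul, subst det_diagonal) (auto simp: signs_def)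
  moreover have "(signs i j ** X) $ unrk 0 $ unrk 0 = 0 \<longleftrightarrow> X $ unrk 0 $ unrk 0 = 0"
    using abs[of "unrk 0"] by (auto simp: ent)
  ultimately show ?thesis by (simp add: seeds_def)
qed

text \<open>A Borel function of the matrices that stands in for \<open>cocA\<close> in the
  integrals: for even n and invertible matrices the two agree wherever it is nonzero, by
  \<open>cocA_generic\<close>.\<close>

definition generic_sign :: "(nat \<Rightarrow> ((real,'n::{finite,linorder}) vec,'n) vec) \<Rightarrow> real" where
  "generic_sign Y = (\<Prod>i\<le>CARD('n). sgn (det (cols (\<lambda>k. column (unrk 0) (Y (skip i k))) :: ((real,'n) vec,'n) vec)))"

definition vertex_sign :: "'n::{finite,linorder} itself \<Rightarrow> real" where
  "vertex_sign _ = (\<Prod>i\<le>CARD('n). sgn (det (cols (\<lambda>k. vtx (skip i k)) :: ((real,'n) vec,'n) vec)))"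

lemma det_vtx_nz:
  assumes "i \<le> CARD('n)"
  shows "det (cols (\<lambda>k. vtx (skip i k)) :: ((real,'n::{finite,linorder}) vec,'n) vec) \<noteq> 0"
proof -
  have s: "skip i (rk c) < Suc CARD('n)" for c :: 'n by (rule skip_less[OF rk_less])
  have "invertible (\<chi> r c. (1::real) * vtx (skip i (rk c)) $ r :: ((real,'n) vec,'n) vec)"
    using assms s
    by (intro invertible_vtx_matrix[where p = i]) (auto simp: skip_neq skip_inj)
  then show ?thesis by (simp add: cols_def invertible_det_nz)
qed

lemma abs_vertex_sign: "\<bar>vertex_sign TYPE('n::{finite,linorder})\<bar> = 1"
  unfolding vertex_sign_def abs_prod using det_vtx_nz[where 'n='n] by (simp add: abs_sgn_eq)

text \<open>The first column for index j tends to a nonzero multiple of vertex j. The limits of the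
  determinants are nonzero, so \<open>sgn\<close> is continuous there, and the signs of the
  multiples cancel because n is even.\<close>

lemma generic_sign_tendsto:
  fixes X :: "nat \<Rightarrow> ((real,'n::{finite,linorder}) vec,'n) vec"
  assumes ev: "even CARD('n)" and X: "\<And>j. j \<le> CARD('n) \<Longrightarrow> X j \<in> seeds"
  shows "((\<lambda>h. generic_sign (\<lambda>j. frame h j ** X j)) \<longlongrightarrow> vertex_sign TYPE('n)) (at 0)"
proof -
  let ?x = "\<lambda>j. X j $ unrk 0 $ unrk 0"
  have fr: "((\<lambda>h. frame h j) \<longlongrightarrow> (frame 0 j :: ((real,'n) vec,'n) vec)) (at 0)" for j
    unfolding frame_def by (intro tendsto_vec_lambda tendsto_intros)
  \<comment> \<open>At h = 0 only the first column of the frame survives, by 0 ^ 0 = 1.\<close>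
  have col: "column (unrk 0) (frame 0 j ** X j) = ?x j *\<^sub>R vtx j" for j
  proof -
    have "column (unrk 0) (frame 0 j ** X j) = (\<Sum>c\<in>(UNIV :: 'n set). X j $ c $ unrk 0 *\<^sub>R column c (frame 0 j))"
      by (simp add: column_matrix_mult matrix_mult_sum scalar_mult_eq_scaleR) (simp add: column_def)
    also have "\<dots> = (\<Sum>c\<in>(UNIV :: 'n set). if c = unrk 0 then ?x j *\<^sub>R vtx (j + Suc CARD('n)) else 0)"
      by (intro sum.cong) (auto simp: column_frame power_0_left rk_eq_0_iff)
    also have "\<dots> = ?x j *\<^sub>R vtx j" using vtx_mod_cong[OF mod_add_self2, of j, where 'n='n] by simp
    finally show ?thesis .
  qed
  have "((\<lambda>h. column (unrk 0) (frame h j ** X j)) \<longlongrightarrow> ?x j *\<^sub>R vtx j) (at 0)" for j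
    unfolding col[symmetric] column_def
    by (intro tendsto_vec_lambda tendsto_vec_nth tendsto_matrix_mult fr tendsto_const)
  then have "((\<lambda>h. cols (\<lambda>k. column (unrk 0) (frame h (skip i k) ** X (skip i k))) :: ((real,'n) vec,'n) vec)
     \<longlongrightarrow> cols (\<lambda>k. ?x (skip i k) *\<^sub>R vtx (skip i k))) (at 0)" for i
    unfolding cols_def by (intro tendsto_vec_lambda tendsto_vec_nth)
  moreover have nz: "?x j \<noteq> 0" if "j \<le> CARD('n)" for j using X[OF that] by (simp add: seeds_def)
  have d: "det (cols (\<lambda>k. ?x (skip i k) *\<^sub>R vtx (skip i k)) :: ((real,'n) vec,'n) vec)
     = (\<Prod>k<CARD('n). ?x (skip i k)) * det (cols (\<lambda>k. vtx (skip i k)) :: ((real,'n) vec,'n) vec)" for i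
    by (rule det_cols_scale)
  have "det (cols (\<lambda>k. ?x (skip i k) *\<^sub>R vtx (skip i k)) :: ((real,'n) vec,'n) vec) \<noteq> 0"
    if "i \<le> CARD('n)" for i
    unfolding d using det_vtx_nz[OF that] nz skip_less[of _ "CARD('n)" i] by (auto simp: less_Suc_eq_le)
  ultimately have "((\<lambda>h. generic_sign (\<lambda>j. frame h j ** X j)) \<longlongrightarrow>
     (\<Prod>i\<le>CARD('n). sgn (det (cols (\<lambda>k. ?x (skip i k) *\<^sub>R vtx (skip i k)) :: ((real,'n) vec,'n) vec)))) (at 0)"
    unfolding generic_sign_def by (intro tendsto_prod tendsto_sgn tendsto_det) auto
  also have "(\<Prod>i\<le>CARD('n). sgn (det (cols (\<lambda>k. ?x (skip i k) *\<^sub>R vtx (skip i k)) :: ((real,'n) vec,'n) vec)))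
    = (\<Prod>i\<le>CARD('n). \<Prod>k<CARD('n). sgn (?x (skip i k))) * vertex_sign TYPE('n)"
    by (simp add: d vertex_sign_def sgn_mult prod_sgn prod.distrib)
  also have "\<dots> = vertex_sign TYPE('n)" using prod_sgn_skip[OF ev, of ?x] nz by simp
  finally show ?thesis .
qed

section \<open>Random tuples of matrices\<close>

lemma space_Mk: "space (Mk k) = PiE {..<k} (\<lambda>_. UNIV)"
  by (simp add: Mk_def space_PiM)

lemma measurable_Mk_component: "j < k \<Longrightarrow> (\<lambda>X. X j) \<in> borel_measurable (Mk k)"
  using measurable_component_singleton[of j "{..<k}" "\<lambda>_. lborel"] by (simp add: Mk_def)

lemma borel_measurable_matrix_mult:
  fixes T :: "((real,'n::finite) vec,'n) vec"
  shows "(\<lambda>X :: ((real,'n) vec,'n) vec. T ** X) \<in> borel_measurable borel"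
  by (intro borel_measurable_continuous_onI) (simp add: continuous_on_def tendsto_matrix_mult)

definition tuple_mult :: "nat \<Rightarrow> (nat \<Rightarrow> ((real,'n) vec,'n) vec) \<Rightarrow> (nat \<Rightarrow> ((real,'n::finite) vec,'n) vec)
    \<Rightarrow> (nat \<Rightarrow> ((real,'n) vec,'n) vec)" where
  "tuple_mult k T X = (\<lambda>j\<in>{..<k}. T j ** X j)"

lemma measurable_tuple_mult [measurable]:
  fixes T :: "nat \<Rightarrow> ((real,'n::finite) vec,'n) vec"
  shows "tuple_mult k T \<in> measurable (Mk k) (Mk k)"
  unfolding tuple_mult_def Mk_def
proof (rule measurable_restrict)
  fix j assume "j \<in> {..<k}"
  then have "(\<lambda>X. X j) \<in> measurable (PiM {..<k} (\<lambda>_. lborel)) borel"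
    using measurable_component_singleton[of j "{..<k}" "\<lambda>_. lborel"] by simp
  from measurable_compose[OF this borel_measurable_matrix_mult[of "T j"]]
  show "(\<lambda>X. T j ** (X j :: ((real,'n) vec,'n) vec)) \<in> measurable (PiM {..<k} (\<lambda>_. lborel)) lborel" by simp
qed

lemma tuple_mult_tuple_mult: "tuple_mult k S (tuple_mult k T X) = tuple_mult k (\<lambda>j. S j ** T j) X"
  by (auto simp: tuple_mult_def matrix_mul_assoc restrict_def)

lemma lborel_matrix_vimage:
  fixes T :: "((real,'n::finite) vec,'n) vec"
  assumes "invertible T"
  shows "\<exists>c>0. \<forall>A\<in>sets borel.
    emeasure lborel ((\<lambda>X :: ((real,'n) vec,'n) vec. T ** X) -` A) = ennreal c * emeasure lborel A"
proof -
  have lin: "linear (\<lambda>X :: ((real,'n) vec,'n) vec. T ** X)"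
    by (auto simp: linear_iff matrix_add_ldistrib matrix_scalar_ac scalar_matrix_assoc)
  obtain T' where "T' ** T = mat 1" using assms by (auto simp: invertible_def)
  then have "T' ** (T ** X) = X" for X :: "((real,'n) vec,'n) vec"
    by (simp add: matrix_mul_assoc)
  then have "inj (\<lambda>X :: ((real,'n) vec,'n) vec. T ** X)" by (metis injI)
  from lborel_linear_vimage[OF lin this] show ?thesis by metis
qed

lemma distr_tuple_mult:
  fixes T :: "nat \<Rightarrow> ((real,'n::finite) vec,'n) vec"
  assumes T: "\<And>j. j < k \<Longrightarrow> invertible (T j)"
  obtains c :: real where "c > 0" "distr (Mk k) (Mk k) (tuple_mult k T) = scale_measure (ennreal c) (Mk k)"
proof -
  have "\<exists>c>0. \<forall>A\<in>sets borel. emeasure lborel ((\<lambda>X :: ((real,'n) vec,'n) vec. T j ** X) -` A) = ennreal c * emeasure lborel A"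
    if "j < k" for j by (rule lborel_matrix_vimage[OF T[OF that]])
  then obtain c :: "nat \<Rightarrow> real" where c: "\<And>j. j < k \<Longrightarrow> c j > 0"
    "\<And>j A. j < k \<Longrightarrow> A \<in> sets borel \<Longrightarrow> emeasure lborel ((\<lambda>X :: ((real,'n) vec,'n) vec. T j ** X) -` A) = ennreal (c j) * emeasure lborel A"
    by metis
  have "distr (Mk k) (Mk k) (tuple_mult k T) = scale_measure (ennreal (prod c {..<k})) (Mk k)"
    unfolding Mk_def tuple_mult_def using c
    by (intro distr_PiM_scale) (auto simp: borel_measurable_matrix_mult)
  moreover have "prod c {..<k} > 0" using c(1) by (intro prod_pos) auto
  ultimately show ?thesis using that by blast
qed

lemma AE_scale_measure:
  assumes "AE x in M. P x"
  shows "AE x in scale_measure r M. P x"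
proof -
  have "space (scale_measure r M) = space M" by (rule sets_eq_imp_space_eq) simp
  then show ?thesis using assms unfolding eventually_ae_filter null_sets_def by force
qed

text \<open>Multiplication by invertible matrices changes the measure by a constant factor only, so
  null sets pull back to null sets. This carries almost everywhere statements over to tuples of the
  form \<open>L j ** X j\<close>.\<close>

lemma AE_tuple_mult:
  assumes "\<And>j. j < k \<Longrightarrow> invertible (T j)" and P: "AE X in Mk k. P X"
  shows "AE X in Mk k. P (tuple_mult k T X)"
proof -
  obtain c where "c > 0" and c: "distr (Mk k) (Mk k) (tuple_mult k T) = scale_measure (ennreal c) (Mk k)"
    by (rule distr_tuple_mult[OF assms(1)])
  have "AE X in distr (Mk k) (Mk k) (tuple_mult k T). P X" unfolding c by (rule AE_scale_measure[OF P])
  then show ?thesis by (rule AE_distrD[OF measurable_tuple_mult])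
qed

text \<open>An involution scales Lebesgue measure by a positive factor with square one.\<close>
lemma distr_tuple_mult_invol:
  fixes T :: "nat \<Rightarrow> ((real,'n::finite) vec,'n) vec"
  assumes T: "\<And>j. j < k \<Longrightarrow> T j ** T j = mat 1"
  shows "distr (Mk k) (Mk k) (tuple_mult k T) = Mk k"
proof -
  have inv: "invertible (T j)" if "j < k" for j using T[OF that] by (auto simp: invertible_def)
  have "emeasure lborel ((\<lambda>X :: ((real,'n) vec,'n) vec. T j ** X) -` A) = ennreal 1 * emeasure lborel A"
    if j: "j < k" and A: "A \<in> sets borel" for j A
  proof -
    obtain c where c: "c > 0"
      "\<And>A. A \<in> sets borel \<Longrightarrow> emeasure lborel ((\<lambda>X :: ((real,'n) vec,'n) vec. T j ** X) -` A) = ennreal c * emeasure lborel A"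
      using lborel_matrix_vimage[OF inv[OF j]] by blast
    \<comment> \<open>A test set of finite positive measure: applying the scaling twice returns it,
      and its measure can be cancelled.\<close>
    let ?B = "ball 0 1 :: ((real,'n) vec,'n) vec set"
    have "emeasure lborel ((\<lambda>X :: ((real,'n) vec,'n) vec. T j ** X) -` ((\<lambda>X :: ((real,'n) vec,'n) vec. T j ** X) -` ?B)) = ennreal c * (ennreal c * emeasure lborel ?B)"
      using measurable_sets_borel[OF borel_measurable_matrix_mult[of "T j"], of ?B] by (simp add: c)
    moreover have "(\<lambda>X :: ((real,'n) vec,'n) vec. T j ** X) -` ((\<lambda>X :: ((real,'n) vec,'n) vec. T j ** X) -` ?B) = ?B"
      by (auto simp: matrix_mul_assoc T[OF j])
    moreover obtain r where r: "emeasure lborel ?B = ennreal r" "r > 0"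
    proof -
      have "emeasure lborel ?B < \<infinity>" by (rule emeasure_lborel_ball_finite)
      moreover have "emeasure lborel ?B > 0"
        by (rule emeasure_lborel_open_pos) auto
      ultimately show ?thesis using that by (cases "emeasure lborel ?B") auto
    qed
    ultimately have "r = c * (c * r)" using c(1) by (simp flip: ennreal_mult)
    then have "c * c = 1" using r(2) by (simp add: mult.assoc[symmetric])
    then have "c = 1" using c(1) by (simp add: square_eq_1_iff)
    then show ?thesis using c(2)[OF A] by simp
  qed
  then have "distr (Mk k) (Mk k) (tuple_mult k T) = scale_measure (ennreal (prod (\<lambda>_. 1) {..<k})) (Mk k)"
    unfolding Mk_def tuple_mult_def
    by (intro distr_PiM_scale) (auto simp: borel_measurable_matrix_mult)
  then show ?thesis by (simp add: scale_measure_1)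
qed

section \<open>Null sets under passage to a face\<close>

definition face :: "nat \<Rightarrow> nat \<Rightarrow> (nat \<Rightarrow> 'a) \<Rightarrow> nat \<Rightarrow> 'a" where
  "face n i X = (\<lambda>j\<in>{..<n}. X (skip i j))"

text \<open>Inserting an independent coordinate at position i identifies \<open>Mk n\<close> times
  Lebesgue measure with \<open>Mk (Suc n)\<close>; the preimage of a null set under
  \<open>face\<close> becomes a cylinder over it.\<close>

lemma AE_face:
  assumes i: "i \<le> n" and P: "AE Y in (Mk n :: (nat \<Rightarrow> ((real,'n::finite) vec,'n) vec) measure). P Y"
  shows "AE X in (Mk (Suc n) :: (nat \<Rightarrow> ((real,'n) vec,'n) vec) measure). P (face n i X)"
proof -
  let ?Mn = "Mk n :: (nat \<Rightarrow> ((real,'n) vec,'n) vec) measure"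
  let ?M = "Mk (Suc n) :: (nat \<Rightarrow> ((real,'n) vec,'n) vec) measure"
  let ?L = "lborel :: ((real,'n) vec,'n) vec measure"
  interpret L: product_sigma_finite "\<lambda>_::nat. ?L" by standard
  interpret Mn: sigma_finite_measure ?Mn unfolding Mk_def by (rule L.sigma_finite) simp
  define unskip where "unskip j = (if j < i then j else j - 1)" for j
  have un: "unskip (skip i j) = j" for j by (auto simp: unskip_def skip_def)
  have skun: "skip i (unskip j) = j" if "j \<noteq> i" for j using that by (auto simp: unskip_def skip_def)
  have unl: "unskip j < n" if "j < Suc n" "j \<noteq> i" for j using that i by (auto simp: unskip_def)
  define ins where "ins = (\<lambda>(Y, y). \<lambda>j\<in>{..<Suc n}. if j = i then (y :: ((real,'n) vec,'n) vec) else Y (unskip j))"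
  have [measurable]: "ins \<in> measurable (?Mn \<Otimes>\<^sub>M ?L) ?M"
  proof -
    have "(\<lambda>x. if j = i then snd x else fst x (unskip j)) \<in> measurable (?Mn \<Otimes>\<^sub>M ?L) ?L"
      if "j < Suc n" for j
    proof (cases "j = i")
      case False
      then have "unskip j < n" using that unl by blast
      then have "(\<lambda>Y. Y (unskip j)) \<in> measurable ?Mn ?L" using measurable_Mk_component by simp
      then have "(\<lambda>x. fst x (unskip j)) \<in> measurable (?Mn \<Otimes>\<^sub>M ?L) ?L"
        using measurable_compose[OF measurable_fst] by blast
      then show ?thesis using False by simp
    qed simp
    then show ?thesis
      unfolding ins_def case_prod_beta Mk_def[of "Suc n"] by (intro measurable_restrict) auto
  qed
  have eq: "distr (?Mn \<Otimes>\<^sub>M ?L) ?M ins = ?M"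
    unfolding Mk_def[of "Suc n"]
  proof (rule L.PiM_eqI)
    fix A :: "nat \<Rightarrow> ((real,'n) vec,'n) vec set"
    assume A: "\<And>j. j \<in> {..<Suc n} \<Longrightarrow> A j \<in> sets ?L"
    have PA: "PiE {..<Suc n} A \<in> sets ?M" unfolding Mk_def using A by (intro sets_PiM_I_finite) auto
    have sk: "skip i j \<in> {..<Suc n}" if "j < n" for j using skip_less[OF that] by simp
    have "ins -` PiE {..<Suc n} A \<inter> space (?Mn \<Otimes>\<^sub>M ?L) = PiE {..<n} (\<lambda>j. A (skip i j)) \<times> A i"
    proof (intro equalityI subsetI)
      fix x assume x: "x \<in> ins -` PiE {..<Suc n} A \<inter> space (?Mn \<Otimes>\<^sub>M ?L)"
      then have 1: "ins x j \<in> A j" if "j < Suc n" for j using that by (auto simp: PiE_iff)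
      have "snd x \<in> A i" using 1[of i] i by (simp add: ins_def case_prod_beta)
      moreover have "fst x j \<in> A (skip i j)" if "j < n" for j
        using 1[of "skip i j"] skip_less[OF that, of i] by (simp add: ins_def case_prod_beta skip_neq un)
      moreover have "fst x \<in> extensional {..<n}" using x by (auto simp: space_pair_measure space_Mk PiE_iff)
      ultimately show "x \<in> PiE {..<n} (\<lambda>j. A (skip i j)) \<times> A i" by (cases x) (auto simp: PiE_iff)
    next
      fix x assume x: "x \<in> PiE {..<n} (\<lambda>j. A (skip i j)) \<times> A i"
      have "ins x j \<in> A j" if j: "j < Suc n" for j
      proof (cases "j = i")
        case True
        then show ?thesis using x j by (simp add: ins_def case_prod_beta mem_Times_iff)
      next
        case False
        then have "fst x (unskip j) \<in> A (skip i (unskip j))"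
          using x unl[OF j] by (simp add: mem_Times_iff PiE_iff)
        then show ?thesis using False j by (simp add: ins_def case_prod_beta skun)
      qed
      moreover have "ins x \<in> extensional {..<Suc n}" by (simp add: ins_def case_prod_beta)
      moreover have "x \<in> space (?Mn \<Otimes>\<^sub>M ?L)"
        using x by (simp add: space_pair_measure space_Mk PiE_iff mem_Times_iff)
      ultimately show "x \<in> ins -` PiE {..<Suc n} A \<inter> space (?Mn \<Otimes>\<^sub>M ?L)"
        by (simp add: PiE_iff)
    qed
    then have "emeasure (distr (?Mn \<Otimes>\<^sub>M ?L) ?M ins) (PiE {..<Suc n} A)
        = emeasure (?Mn \<Otimes>\<^sub>M ?L) (PiE {..<n} (\<lambda>j. A (skip i j)) \<times> A i)"
      using PA by (simp add: emeasure_distr)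
    also have "\<dots> = emeasure ?Mn (PiE {..<n} (\<lambda>j. A (skip i j))) * emeasure ?L (A i)"
      using A sk i unfolding Mk_def
      by (intro lborel.emeasure_pair_measure_Times sets_PiM_I_finite) auto
    also have "emeasure ?Mn (PiE {..<n} (\<lambda>j. A (skip i j))) = (\<Prod>j<n. emeasure ?L (A (skip i j)))"
      unfolding Mk_def using A sk by (intro L.emeasure_PiM) auto
    also have "\<dots> = (\<Prod>j\<in>skip i ` {..<n}. emeasure ?L (A j))"
      by (subst prod.reindex) (auto simp: skip_inj intro: inj_onI)
    also have "\<dots> * emeasure ?L (A i) = (\<Prod>j\<in>{..<Suc n}. emeasure ?L (A j))"
      using i by (simp add: skip_image lessThan_Suc_atMost prod.remove[of "{..n}" i] mult.commute)
    finally show "emeasure (distr (?Mn \<Otimes>\<^sub>M ?L) (PiM {..<Suc n} (\<lambda>_. ?L)) ins) (PiE {..<Suc n} A)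
        = (\<Prod>j\<in>{..<Suc n}. emeasure ?L (A j))" by (simp add: Mk_def[of "Suc n"])
  qed simp_all
  have face_meas[measurable]: "face n i \<in> measurable ?M ?Mn"
    unfolding face_def Mk_def[of n]
    using measurable_Mk_component[of "skip i _" "Suc n"] skip_less[of _ n i]
    by (intro measurable_restrict) auto
  obtain N where N: "N \<in> null_sets ?Mn" "{Y\<in>space ?Mn. \<not> P Y} \<subseteq> N"
    using P by (auto simp: eventually_ae_filter)
  have Nm[measurable]: "N \<in> sets ?Mn" using N by auto
  let ?N' = "face n i -` N \<inter> space ?M"
  have "emeasure ?M ?N' = emeasure (distr (?Mn \<Otimes>\<^sub>M ?L) ?M ins) ?N'" by (simp only: eq)
  also have "\<dots> = emeasure (?Mn \<Otimes>\<^sub>M ?L) (ins -` ?N' \<inter> space (?Mn \<Otimes>\<^sub>M ?L))"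
    by (rule emeasure_distr) measurable
  also have "ins -` ?N' \<inter> space (?Mn \<Otimes>\<^sub>M ?L) = N \<times> UNIV"
  proof -
    have "face n i (ins x) = fst x" if "fst x \<in> space ?Mn" for x
    proof
      fix j show "face n i (ins x) j = fst x j"
        using that skip_less[of j n i]
        by (auto simp: face_def ins_def case_prod_beta skip_neq un space_Mk PiE_iff extensional_def)
    qed
    moreover have "ins x \<in> space ?M" for x by (auto simp: ins_def case_prod_beta space_Mk)
    ultimately show ?thesis using sets.sets_into_space[OF Nm] by (auto simp: space_pair_measure)
  qed
  also have "emeasure (?Mn \<Otimes>\<^sub>M ?L) (N \<times> UNIV) = emeasure ?Mn N * emeasure ?L UNIV"
    by (rule lborel.emeasure_pair_measure_Times) auto
  \<comment> \<open>\<open>UNIV\<close> has infinite Lebesgue measure; the product vanishes because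
    0 times infinity is 0 in \<open>ennreal\<close>.\<close>
  also have "\<dots> = 0" using N by auto
  finally have "?N' \<in> null_sets ?M" by (auto simp: null_sets_def)
  moreover have "{X\<in>space ?M. \<not> P (face n i X)} \<subseteq> ?N'"
    using N(2) measurable_space[OF face_meas] by auto
  ultimately show ?thesis unfolding eventually_ae_filter by blast
qed

section \<open>Independent uniform seed matrices\<close>

definition seed_measure :: "((real,'n::{finite,linorder}) vec,'n) vec measure" where
  "seed_measure = uniform_measure lborel seeds"

definition seed_tuples :: "nat \<Rightarrow> (nat \<Rightarrow> ((real,'n::{finite,linorder}) vec,'n) vec) measure" where
  "seed_tuples k = PiM {..<k} (\<lambda>_. seed_measure)"

lemma seeds_borel [measurable]: "(seeds :: ((real,'n::{finite,linorder}) vec,'n) vec set) \<in> sets borel"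
  by (rule borel_open[OF open_seeds])

lemma emeasure_seeds:
  obtains q where "q > 0" "emeasure lborel (seeds :: ((real,'n::{finite,linorder}) vec,'n) vec set) = ennreal q"
proof -
  have "bounded (seeds :: ((real,'n) vec,'n) vec set)"
    by (rule bounded_subset[of "ball 0 1"]) (auto simp: seeds_def)
  then have "emeasure lborel (seeds :: ((real,'n) vec,'n) vec set) < \<infinity>" by (rule emeasure_bounded_finite)
  moreover have "0 < emeasure lborel (seeds :: ((real,'n) vec,'n) vec set)"
    using open_seeds seeds_nonempty by (rule emeasure_lborel_open_pos)
  ultimately show ?thesis using that
    by (cases "emeasure lborel (seeds :: ((real,'n) vec,'n) vec set)") auto
qed

lemma prob_space_seed_measure: "prob_space (seed_measure :: ((real,'n::{finite,linorder}) vec,'n) vec measure)"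
proof -
  obtain q where "q > 0" "emeasure lborel (seeds :: ((real,'n) vec,'n) vec set) = ennreal q"
    by (rule emeasure_seeds)
  then show ?thesis unfolding seed_measure_def by (intro prob_space_uniform_measure) auto
qed

lemma sets_seed_tuples: "sets (seed_tuples k) = sets (Mk k :: (nat \<Rightarrow> ((real,'n::{finite,linorder}) vec,'n) vec) measure)"
  unfolding seed_tuples_def Mk_def by (intro sets_PiM_cong) (auto simp: seed_measure_def)

lemma prob_space_seed_tuples: "prob_space (seed_tuples k :: (nat \<Rightarrow> ((real,'n::{finite,linorder}) vec,'n) vec) measure)"
  unfolding seed_tuples_def by (intro prob_space_PiM prob_space_seed_measure)

lemma PiE_seeds_sets [measurable]:
  "PiE {..<k} (\<lambda>_. seeds :: ((real,'n::{finite,linorder}) vec,'n) vec set) \<in> sets (Mk k)"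
  unfolding Mk_def by (intro sets_PiM_I_finite) auto

text \<open>Independence serves for the marginals on faces, the uniform description for comparison
  with Lebesgue measure, where the invariance under involutions is known.\<close>

lemma seed_tuples_eq: "seed_tuples k = uniform_measure (Mk k) (PiE {..<k} (\<lambda>_. seeds :: ((real,'n::{finite,linorder}) vec,'n) vec set))"
proof -
  let ?Q = "seeds :: ((real,'n) vec,'n) vec set"
  interpret L: product_sigma_finite "\<lambda>_::nat. lborel :: ((real,'n) vec,'n) vec measure" by standard
  interpret U: prob_space "seed_measure :: ((real,'n) vec,'n) vec measure" by (rule prob_space_seed_measure)
  interpret U: product_sigma_finite "\<lambda>_::nat. seed_measure :: ((real,'n) vec,'n) vec measure" by standard
  obtain q where q: "q > 0" "emeasure lborel ?Q = ennreal q" by (rule emeasure_seeds)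
  have "uniform_measure (Mk k) (PiE {..<k} (\<lambda>_. ?Q)) = PiM {..<k} (\<lambda>_. seed_measure)"
  proof (rule U.PiM_eqI)
    show "sets (uniform_measure (Mk k) (PiE {..<k} (\<lambda>_. ?Q))) = sets (PiM {..<k} (\<lambda>_. seed_measure))"
      using sets_seed_tuples[of k, where 'n='n] by (simp add: seed_tuples_def)
    fix A assume A: "\<And>i. i \<in> {..<k} \<Longrightarrow> A i \<in> sets (seed_measure :: ((real,'n) vec,'n) vec measure)"
    then have A': "A i \<in> sets borel" if "i < k" for i using that by (simp add: seed_measure_def)
    have "\<exists>a\<ge>0. emeasure lborel (?Q \<inter> A i) = ennreal a" for i
    proof -
      have "emeasure lborel (?Q \<inter> A i) \<le> emeasure lborel ?Q" by (rule emeasure_mono) auto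
      then show ?thesis using q by (cases "emeasure lborel (?Q \<inter> A i)") (auto simp: top_unique)
    qed
    then obtain a where a: "\<And>i. a i \<ge> 0" "\<And>i. emeasure lborel (?Q \<inter> A i) = ennreal (a i)" by metis
    have PA: "PiE {..<k} A \<in> sets (Mk k)" unfolding Mk_def using A' by (intro sets_PiM_I_finite) auto
    have "emeasure (uniform_measure (Mk k) (PiE {..<k} (\<lambda>_. ?Q))) (PiE {..<k} A)
       = emeasure (Mk k) (PiE {..<k} (\<lambda>i. ?Q \<inter> A i)) / emeasure (Mk k) (PiE {..<k} (\<lambda>_. ?Q))"
      using PA by (simp add: PiE_Int)
    also have "emeasure (Mk k) (PiE {..<k} (\<lambda>i. ?Q \<inter> A i)) = (\<Prod>i<k. ennreal (a i))"
      unfolding Mk_def a(2)[symmetric] using A' by (intro L.emeasure_PiM) auto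
    also have "emeasure (Mk k) (PiE {..<k} (\<lambda>_. ?Q)) = (\<Prod>i<k. ennreal q)"
      unfolding Mk_def q(2)[symmetric] by (intro L.emeasure_PiM) auto
    also have "(\<Prod>i<k. ennreal (a i)) / (\<Prod>i<k. ennreal q) = ennreal ((\<Prod>i<k. a i) / (\<Prod>i<k. q))"
      using a(1) q(1) by (subst (1 2) prod_ennreal) (auto intro!: divide_ennreal prod_nonneg)
    also have "\<dots> = ennreal (\<Prod>i<k. a i / q)" by (simp only: prod_dividef)
    also have "\<dots> = (\<Prod>i<k. ennreal (a i / q))" using a(1) q(1) by (subst prod_ennreal) auto
    also have "\<dots> = (\<Prod>i<k. emeasure seed_measure (A i))"
      using A' a q by (intro prod.cong) (auto simp: seed_measure_def divide_ennreal)
    finally show "emeasure (uniform_measure (Mk k) (PiE {..<k} (\<lambda>_. ?Q))) (PiE {..<k} A)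
       = (\<Prod>i\<in>{..<k}. emeasure seed_measure (A i))" .
  qed simp
  then show ?thesis by (simp add: seed_tuples_def)
qed

lemma AE_seed_tuples:
  fixes P :: "(nat \<Rightarrow> ((real,'n::{finite,linorder}) vec,'n) vec) \<Rightarrow> bool"
  assumes "AE X in Mk k. (\<forall>j<k. X j \<in> seeds) \<longrightarrow> P X"
  shows "AE X in seed_tuples k. P X"
  unfolding seed_tuples_eq
proof (rule AE_uniform_measureI)
  show "AE X in Mk k. X \<in> PiE {..<k} (\<lambda>_. seeds) \<longrightarrow> P X"
    using assms by eventually_elim (auto simp: PiE_iff)
qed simp

lemma AE_seed_tuples_seeds: "AE X in seed_tuples k. \<forall>j<k. X j \<in> seeds"
  by (rule AE_seed_tuples) simp

lemma seeds_invertible: "X \<in> seeds \<Longrightarrow> invertible X"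
  by (simp add: seeds_def invertible_det_nz)

text \<open>The factor r is left unspecified because the identity is applied to an integral over
  Lebesgue measure that vanishes.\<close>

lemma integral_seed_tuples:
  fixes f :: "(nat \<Rightarrow> ((real,'n::{finite,linorder}) vec,'n) vec) \<Rightarrow> real"
  assumes [measurable]: "f \<in> borel_measurable (Mk k)"
  obtains r where "(\<integral>X. f X \<partial>seed_tuples k) = r * (\<integral>X. indicator (PiE {..<k} (\<lambda>_. seeds)) X * f X \<partial>Mk k)"
proof -
  let ?B = "PiE {..<k} (\<lambda>_. seeds :: ((real,'n) vec,'n) vec set)"
  have "(\<integral>X. f X \<partial>seed_tuples k) = (\<integral>X. f X \<partial>density (Mk k) (\<lambda>X. ennreal (indicator ?B X / measure (Mk k) ?B)))"
  proof -
    have "density (Mk k) (\<lambda>X. indicator ?B X / emeasure (Mk k) ?B) = density (Mk k) (\<lambda>X. ennreal (indicator ?B X / measure (Mk k) ?B))"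
      if fin: "emeasure (Mk k) ?B \<noteq> 0" "emeasure (Mk k) ?B \<noteq> \<infinity>"
    proof -
      obtain b where b: "b > 0" "emeasure (Mk k) ?B = ennreal b"
        using fin by (cases "emeasure (Mk k) ?B") (auto simp: less_le)
      then have "measure (Mk k) ?B = b" by (simp add: measure_def)
      then have "indicator ?B X / emeasure (Mk k) ?B = ennreal (indicator ?B X / measure (Mk k) ?B)" for X
        using b by (cases "X \<in> ?B") (auto simp: divide_ennreal[symmetric])
      then show ?thesis by simp
    qed
    \<comment> \<open>The total mass of the uniform measure is the quotient of the measure of the
      box by itself; that it is 1 excludes the values 0 and infinity.\<close>
    moreover have "emeasure (Mk k) ?B \<noteq> 0 \<and> emeasure (Mk k) ?B \<noteq> \<infinity>"
    proof -
      have "emeasure (uniform_measure (Mk k) ?B) (space (uniform_measure (Mk k) ?B)) = 1"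
        using prob_space.emeasure_space_1[OF prob_space_seed_tuples[of k]] unfolding seed_tuples_eq .
      then have "emeasure (Mk k) (?B \<inter> space (Mk k)) / emeasure (Mk k) ?B = 1" by simp
      then show ?thesis by (auto simp: sets.Int_space_eq2 top_unique)
    qed
    ultimately show ?thesis unfolding seed_tuples_eq uniform_measure_def by simp
  qed
  also have "\<dots> = (\<integral>X. (indicator ?B X / measure (Mk k) ?B) *\<^sub>R f X \<partial>Mk k)"
    by (rule integral_density) auto
  also have "\<dots> = (\<integral>X. (1 / measure (Mk k) ?B) * (indicator ?B X * f X) \<partial>Mk k)" by simp
  also have "\<dots> = (1 / measure (Mk k) ?B) * (\<integral>X. indicator ?B X * f X \<partial>Mk k)"
    by (rule integral_mult_right_zero)
  finally show ?thesis using that by blast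
qed

section \<open>The semi-norm\<close>

lemma skip_mod_neq: "i \<le> n \<Longrightarrow> j < n \<Longrightarrow> i mod Suc n \<noteq> skip i j mod Suc n"
  using skip_less[of j n i] skip_neq[of i j] by simp

text \<open>Nothing is required of X itself; the intersection with the tuples of seeds is the set
  that the reflection, read in the frames, maps to itself.\<close>

definition stay :: "real \<Rightarrow> nat \<Rightarrow> (nat \<Rightarrow> ((real,'n::{finite,linorder}) vec,'n) vec) set" where
  "stay h i = {X \<in> space (Mk CARD('n)). \<forall>j<CARD('n). frame_reflection h i (skip i j) ** X j \<in> seeds}"

lemma stay_eq:
  "stay h i = tuple_mult CARD('n) (\<lambda>j. frame_reflection h i (skip i j)) -` PiE {..<CARD('n)} (\<lambda>_. seeds)
     \<inter> space (Mk CARD('n) :: (nat \<Rightarrow> ((real,'n::{finite,linorder}) vec,'n) vec) measure)"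
  unfolding stay_def tuple_mult_def by (rule set_eqI) (simp add: PiE_iff Ball_def conj_commute)

lemma stay_sets [measurable]:
  "stay h i \<in> sets (Mk CARD('n) :: (nat \<Rightarrow> ((real,'n::{finite,linorder}) vec,'n) vec) measure)"
  unfolding stay_eq by (rule measurable_sets[OF measurable_tuple_mult PiE_seeds_sets])

lemma integrable_seed_tuples_bounded:
  fixes f :: "(nat \<Rightarrow> ((real,'n::{finite,linorder}) vec,'n) vec) \<Rightarrow> real"
  assumes "f \<in> borel_measurable (Mk k)" "\<And>X. \<bar>f X\<bar> \<le> K"
  shows "integrable (seed_tuples k) f"
proof -
  interpret prob_space "seed_tuples k :: (nat \<Rightarrow> ((real,'n) vec,'n) vec) measure" by (rule prob_space_seed_tuples)
  have "f \<in> borel_measurable (seed_tuples k)" using assms(1) by (simp cong: measurable_cong_sets add: sets_seed_tuples)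
  then show ?thesis using assms(2) by (intro integrable_const_bound[of _ K]) auto
qed

text \<open>On the part of the sample space that the reflection maps to itself, the
  anti-invariant integrand has integral zero.\<close>
lemma face_integral_bound:
  fixes b :: "(nat \<Rightarrow> ((real,'n::{finite,linorder}) vec,'n) vec) \<Rightarrow> real"
  assumes h: "h \<noteq> 0" and i: "i \<le> CARD('n)"
    and b[measurable]: "b \<in> borel_measurable (Mk CARD('n))" and K: "\<And>X. \<bar>b X\<bar> \<le> K"
    and anti: "AE X in Mk CARD('n). (\<forall>j<CARD('n). invertible (X j)) \<longrightarrow>
       b (tuple_mult CARD('n) (\<lambda>_. reflection i) X) = - b X"
  shows "\<bar>\<integral>X. b (tuple_mult CARD('n) (\<lambda>j. frame h (skip i j)) X) \<partial>seed_tuples CARD('n)\<bar>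
     \<le> K * (\<integral>X. 1 - indicator (stay h i) X \<partial>(seed_tuples CARD('n) :: (nat \<Rightarrow> ((real,'n) vec,'n) vec) measure))"
proof -
  let ?n = "CARD('n)"
  let ?M = "Mk ?n :: (nat \<Rightarrow> ((real,'n) vec,'n) vec) measure"
  let ?P = "seed_tuples ?n :: (nat \<Rightarrow> ((real,'n) vec,'n) vec) measure"
  let ?B = "PiE {..<?n} (\<lambda>_. seeds :: ((real,'n) vec,'n) vec set)"
  define L where "L j = (frame h (skip i j) :: ((real,'n) vec,'n) vec)" for j
  define T where "T j = (frame_reflection h i (skip i j) :: ((real,'n) vec,'n) vec)" for j
  define H where "H X = b (tuple_mult ?n L X)" for X
  have H_meas[measurable]: "H \<in> borel_measurable ?M" unfolding H_def by measurable
  have L_inv: "invertible (L j)" for j unfolding L_def using h by (rule invertible_frame)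
  have TT: "T j ** T j = mat 1" if "j < ?n" for j
    unfolding T_def by (rule frame_reflection_invol[OF skip_mod_neq[OF i that] h])
  have LT: "reflection i ** L j = L j ** T j" if "j < ?n" for j
    unfolding T_def L_def by (rule reflection_frame[OF skip_mod_neq[OF i that]])
  have stay_T: "stay h i = tuple_mult ?n T -` ?B \<inter> space ?M" unfolding stay_eq T_def ..
  have TTX: "tuple_mult ?n T (tuple_mult ?n T X) = X" if "X \<in> space ?M" for X
    using that by (auto simp: tuple_mult_def matrix_mul_assoc TT space_Mk fun_eq_iff PiE_iff extensional_def)
  \<comment> \<open>The anti-invariance is evaluated at \<open>L j ** X j\<close>, where
    \<open>LT\<close> moves the reflection past the frame and turns it into \<open>T j\<close>
    acting on X.\<close>
  have "AE X in ?M. (\<forall>j<?n. invertible (tuple_mult ?n L X j)) \<longrightarrow>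
       b (tuple_mult ?n (\<lambda>_. reflection i) (tuple_mult ?n L X)) = - b (tuple_mult ?n L X)"
    by (rule AE_tuple_mult[OF L_inv anti])
  then have antiH: "AE X in ?M. (\<forall>j<?n. invertible (X j)) \<longrightarrow> H (tuple_mult ?n T X) = - H X"
  proof eventually_elim
    case (elim X)
    have "tuple_mult ?n (\<lambda>_. reflection i) (tuple_mult ?n L X) = tuple_mult ?n L (tuple_mult ?n T X)"
      unfolding tuple_mult_tuple_mult using LT by (auto simp: tuple_mult_def)
    moreover have "invertible (tuple_mult ?n L X j)" if "j < ?n" "invertible (X j)" for j
      using that L_inv by (simp add: tuple_mult_def invertible_mult)
    ultimately show ?case using elim by (simp add: H_def)
  qed
  let ?S = "?B \<inter> stay h i"
  \<comment> \<open>Applying T exchanges the two conditions that define the intersection, since T is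
    an involution on tuples.\<close>
  have S_T: "tuple_mult ?n T X \<in> ?S \<longleftrightarrow> X \<in> ?S" if "X \<in> space ?M" for X
    using that TTX[OF that] measurable_space[OF measurable_tuple_mult that] by (auto simp: stay_T)
  have "(\<integral>X. indicator ?S X * H X \<partial>?M) = (\<integral>X. indicator ?S X * H X \<partial>distr ?M ?M (tuple_mult ?n T))"
    by (simp add: distr_tuple_mult_invol[OF TT])
  also have "\<dots> = (\<integral>X. indicator ?S (tuple_mult ?n T X) * H (tuple_mult ?n T X) \<partial>?M)"
    by (rule integral_distr) measurable
  also have "\<dots> = (\<integral>X. - (indicator ?S X * H X) \<partial>?M)"
  proof (rule integral_cong_AE)
    show "AE X in ?M. indicator ?S (tuple_mult ?n T X) * H (tuple_mult ?n T X) = - (indicator ?S X * H X)"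
      using antiH AE_space
    proof eventually_elim
      case (elim X)
      show ?case
      proof (cases "X \<in> ?S")
        case True
        then have "\<forall>j<?n. invertible (X j)" by (auto simp: PiE_iff intro: seeds_invertible)
        then have "H (tuple_mult ?n T X) = - H X" using elim by blast
        moreover have "tuple_mult ?n T X \<in> ?S" using True S_T[OF elim(2)] by blast
        ultimately show ?thesis using True by (simp only: indicator_simps)
      next
        case False
        moreover have "tuple_mult ?n T X \<notin> ?S" using False S_T[OF elim(2)] by blast
        ultimately show ?thesis
          by (simp only: indicator_simps not_False_eq_True mult_zero_left minus_zero)
      qed
    qed
  qed measurable
  also have "\<dots> = - (\<integral>X. indicator ?S X * H X \<partial>?M)" by (rule integral_minus)
  finally have zero: "(\<integral>X. indicator ?S X * H X \<partial>?M) = 0" by simp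
  \<comment> \<open>The vanishing integral over Lebesgue measure is carried over to the random
    seeds; only tuples outside \<open>stay\<close> then contribute to the mean of H, each at most
    K.\<close>
  obtain r where "(\<integral>X. indicator (stay h i) X * H X \<partial>?P)
      = r * (\<integral>X. indicator ?B X * (indicator (stay h i) X * H X) \<partial>?M)"
    by (rule integral_seed_tuples[of "\<lambda>X. indicator (stay h i) X * H X"]) measurable
  also have "(\<integral>X. indicator ?B X * (indicator (stay h i) X * H X) \<partial>?M) = (\<integral>X. indicator ?S X * H X \<partial>?M)"
    by (intro Bochner_Integration.integral_cong) (auto simp: indicator_def)
  finally have zero': "(\<integral>X. indicator (stay h i) X * H X \<partial>?P) = 0" by (simp add: zero)
  have KH: "\<bar>H X\<bar> \<le> K" for X unfolding H_def by (rule K)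
  have K0: "K \<ge> 0" using KH[of undefined] by linarith
  have int1: "integrable ?P H" by (rule integrable_seed_tuples_bounded[OF H_meas KH])
  have int2: "integrable ?P (\<lambda>X. indicator (stay h i) X * H X)"
    by (rule integrable_seed_tuples_bounded[where K = K], measurable) (use KH K0 in \<open>auto simp: indicator_def\<close>)
  have int3: "integrable ?P (\<lambda>X. K * (1 - indicator (stay h i) X))"
    by (rule integrable_seed_tuples_bounded[where K = K], measurable) (use K0 in \<open>auto simp: indicator_def\<close>)
  have "\<bar>\<integral>X. H X \<partial>?P\<bar> = \<bar>\<integral>X. H X - indicator (stay h i) X * H X \<partial>?P\<bar>"
    using int1 int2 by (simp add: zero')
  also have "\<dots> \<le> (\<integral>X. \<bar>H X - indicator (stay h i) X * H X\<bar> \<partial>?P)" by (rule integral_abs_bound)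
  also have "\<dots> \<le> (\<integral>X. K * (1 - indicator (stay h i) X) \<partial>?P)"
    using int1 int2 int3 KH K0 by (intro integral_mono) (auto simp: indicator_def)
  also have "\<dots> = K * (\<integral>X. 1 - indicator (stay h i) X \<partial>?P)" by simp
  finally show ?thesis by (simp add: H_def L_def[abs_def])
qed

text \<open>Dominated convergence is applied along a sequence of values of h; these are nonzero, as
  invertibility of the frames requires.\<close>

abbreviation step :: "nat \<Rightarrow> real" where
  "step k \<equiv> inverse (real (Suc k))"

lemma step_at_0: "filterlim step (at 0) sequentially"
  unfolding filterlim_at using LIMSEQ_inverse_real_of_nat by (auto simp del: of_nat_Suc)

text \<open>For a tuple of seeds the matrices \<open>frame_reflection h i (skip i j) ** X j\<close>
  tend to \<open>signs i (skip i j) ** X j\<close>, which are again seeds. As \<open>seeds\<close>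
  is open, the tuple eventually lies in \<open>stay\<close>, and dominated convergence
  applies.\<close>

lemma stay_tendsto:
  "(\<lambda>k. \<integral>X. (1 - indicator (stay (step k) i) X :: real) \<partial>(seed_tuples CARD('n) :: (nat \<Rightarrow> ((real,'n::{finite,linorder}) vec,'n) vec) measure))
     \<longlonglongrightarrow> 0"
proof -
  let ?P = "seed_tuples CARD('n) :: (nat \<Rightarrow> ((real,'n) vec,'n) vec) measure"
  interpret prob_space ?P by (rule prob_space_seed_tuples)
  have [measurable]: "stay h i \<in> sets ?P" for h by (simp add: sets_seed_tuples)
  have "(\<lambda>k. \<integral>X. 1 - indicator (stay (step k) i) X \<partial>?P) \<longlonglongrightarrow> (\<integral>X. (0::real) \<partial>?P)"
  proof (rule integral_dominated_convergence[where w = "\<lambda>_. 1"])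
    show "AE X in ?P. (\<lambda>k. 1 - indicator (stay (step k) i) X :: real) \<longlonglongrightarrow> 0"
      using AE_seed_tuples_seeds[of "CARD('n)"] AE_space
    proof eventually_elim
      case (elim X)
      have sp: "X \<in> space (Mk CARD('n))" using elim(2) sets_eq_imp_space_eq[OF sets_seed_tuples] by blast
      have "eventually (\<lambda>k. frame_reflection (step k) i (skip i j) ** X j \<in> seeds) sequentially" if "j < CARD('n)" for j
      proof (rule topological_tendstoD[OF _ open_seeds])
        show "(\<lambda>k. frame_reflection (step k) i (skip i j) ** X j) \<longlonglongrightarrow> signs i (skip i j) ** X j"
          by (rule filterlim_compose[OF frame_reflection_tendsto step_at_0])
        show "signs i (skip i j) ** X j \<in> seeds" using elim that by (simp add: signs_seeds)
      qed
      then have "eventually (\<lambda>k. \<forall>j\<in>{..<CARD('n)}. frame_reflection (step k) i (skip i j) ** X j \<in> seeds) sequentially"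
        by (intro eventually_ball_finite) auto
      then have "eventually (\<lambda>k. X \<in> stay (step k) i) sequentially"
        by eventually_elim (use sp in \<open>auto simp: stay_def\<close>)
      then have "eventually (\<lambda>k. 1 - indicator (stay (step k) i) X = (0 :: real)) sequentially"
        by eventually_elim simp
      then show ?case by (rule tendsto_eventually)
    qed
  qed (auto simp: indicator_def)
  then show ?thesis by simp
qed

section \<open>Negligible sets of flags and bounded representatives\<close>

lemma negl_AE:
  fixes S :: "(nat \<Rightarrow> 'n::{finite,linorder} flag) set"
  assumes "negl k S"
  shows "AE X in Mk k. (\<forall>j<k. invertible (X j)) \<longrightarrow> tuple_of k X \<notin> S"
proof -
  obtain N where N: "N \<in> null_sets (Mk k :: (nat \<Rightarrow> ((real,'n) vec,'n) vec) measure)"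
     "{gs \<in> space (Mk k). (\<forall>j<k. invertible (gs j)) \<and> tuple_of k gs \<in> S} \<subseteq> N"
    using assms unfolding negl_def by blast
  show ?thesis using N by (intro AE_I'[of N]) auto
qed

lemma AE_negl:
  fixes S :: "(nat \<Rightarrow> 'n::{finite,linorder} flag) set"
  assumes "AE X in Mk k. (\<forall>j<k. invertible (X j)) \<longrightarrow> tuple_of k X \<notin> S"
  shows "negl k S"
proof -
  obtain N where N: "N \<in> null_sets (Mk k :: (nat \<Rightarrow> ((real,'n) vec,'n) vec) measure)"
    "{X \<in> space (Mk k). \<not> ((\<forall>j<k. invertible (X j)) \<longrightarrow> tuple_of k X \<notin> S)} \<subseteq> N"
    using assms unfolding eventually_ae_filter by blast
  then show ?thesis unfolding negl_def by (intro bexI[of _ N]) auto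
qed

lemma tuple_of_ftuples:
  assumes "\<And>j. j < k \<Longrightarrow> invertible (X j)"
  shows "tuple_of k X \<in> ftuples k"
  unfolding tuple_of_def ftuples_def flags_def using assms is_flag_flag_of by (auto simp: PiE_iff)

lemma tuple_of_tuple_mult:
  "restrict (\<lambda>j. act g (tuple_of k X j)) {..<k} = tuple_of k (tuple_mult k (\<lambda>_. g) X)"
  by (auto simp: tuple_of_def tuple_mult_def act_flag_of restrict_def)

lemma cobound_tuple_of:
  "cobound (n + 1) \<beta> (tuple_of (Suc n) X) = (\<Sum>i\<le>n. (-1) ^ i * \<beta> (tuple_of n (face n i X)))"
proof -
  have "restrict (\<lambda>j. if j < i then tuple_of (Suc n) X j else tuple_of (Suc n) X (Suc j)) {..<n}
      = tuple_of n (face n i X)" for i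
    by (auto simp: tuple_of_def face_def skip_def restrict_def)
  then show ?thesis unfolding cobound_def by (simp add: lessThan_Suc_atMost)
qed

lemma face_tuple_mult: "face n i (tuple_mult (Suc n) L X) = tuple_mult n (\<lambda>j. L (skip i j)) (face n i X)"
  using skip_less[of _ n i] by (auto simp: face_def tuple_mult_def restrict_def)

lemma distr_face_seed_tuples:
  "distr (seed_tuples (Suc n)) (seed_tuples n) (face n i) = (seed_tuples n :: (nat \<Rightarrow> ((real,'n::{finite,linorder}) vec,'n) vec) measure)"
proof -
  have "distr (PiM {..<Suc n} (\<lambda>_. seed_measure)) (PiM {..<n} (\<lambda>_. seed_measure)) (\<lambda>\<omega>. \<lambda>j\<in>{..<n}. \<omega> (skip i j))
     = PiM {..<n} (\<lambda>_. seed_measure :: ((real,'n) vec,'n) vec measure)"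
    by (rule distr_PiM_reindex[where M = "\<lambda>_. seed_measure"])
      (auto simp: prob_space_seed_measure skip_inj intro: inj_onI skip_less)
  then show ?thesis unfolding seed_tuples_def face_def[abs_def] .
qed

lemma measurable_face_seed_tuples:
  "face n i \<in> measurable (seed_tuples (Suc n)) (seed_tuples n :: (nat \<Rightarrow> ((real,'n::{finite,linorder}) vec,'n) vec) measure)"
  unfolding seed_tuples_def face_def[abs_def]
  using skip_less[of _ n i] by (intro measurable_restrict measurable_component_singleton) auto

text \<open>A cochain is measurable only for the completion and bounded only off a null set.
  Truncating a Borel version at the essential bound repairs both without changing it almost
  everywhere on invertible tuples.\<close>

lemma AE_bounded_representative:
  fixes \<beta> :: "(nat \<Rightarrow> 'n::{finite,linorder} flag) \<Rightarrow> real"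
  assumes "\<beta> \<in> LinfG k"
  obtains b K where "b \<in> borel_measurable (Mk k)" "\<And>X. \<bar>b X\<bar> \<le> K"
    "AE X in Mk k. (\<forall>j<k. invertible (X j)) \<longrightarrow> b X = \<beta> (tuple_of k X)"
proof -
  from assms have meas: "fmeas k \<beta>" and bdd: "ess_bdd k \<beta>" by (auto simp: LinfG_def)
  obtain g where g[measurable]: "g \<in> borel_measurable (Mk k)"
    and geq: "AE X in Mk k. \<beta> (tuple_of k X) = g X"
    using completion_ex_borel_measurable_real meas unfolding fmeas_def by blast
  obtain C where C: "negl k {Fs \<in> ftuples k. C < \<bar>\<beta> Fs\<bar>}" using bdd by (auto simp: ess_bdd_def)
  \<comment> \<open>The essential bound C is not known to be nonnegative, and the truncation to
    [-K, K] needs that.\<close>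
  define K where "K = max C 0"
  show ?thesis
  proof
    show "(\<lambda>X. max (- K) (min K (g X))) \<in> borel_measurable (Mk k)" by measurable
    show "\<bar>max (- K) (min K (g X))\<bar> \<le> K" for X by (auto simp: K_def)
    show "AE X in Mk k. (\<forall>j<k. invertible (X j)) \<longrightarrow> max (- K) (min K (g X)) = \<beta> (tuple_of k X)"
      using geq negl_AE[OF C]
    proof eventually_elim
      case (elim X)
      show ?case
      proof
        assume inv: "\<forall>j<k. invertible (X j)"
        then have "\<bar>\<beta> (tuple_of k X)\<bar> \<le> C" using elim tuple_of_ftuples[of k X] by auto
        then show "max (- K) (min K (g X)) = \<beta> (tuple_of k X)" using elim by (auto simp: K_def)
      qed
    qed
  qed
qed

text \<open>The reflection has determinant - 1, which produces the sign. The representative may be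
  replaced by the cochain at the reflected tuple too, because the reflection preserves null
  sets.\<close>

lemma representative_anti_invariant:
  fixes \<beta> :: "(nat \<Rightarrow> 'n::{finite,linorder} flag) \<Rightarrow> real"
  assumes \<beta>: "\<beta> \<in> LinfG k"
    and rep: "AE X in Mk k. (\<forall>j<k. invertible (X j)) \<longrightarrow> b X = \<beta> (tuple_of k X)"
  shows "AE X in Mk k. (\<forall>j<k. invertible (X j)) \<longrightarrow> b (tuple_mult k (\<lambda>_. reflection i) X) = - b X"
proof -
  let ?g = "reflection i :: ((real,'n) vec,'n) vec"
  have inv: "invertible ?g" using reflection_invol[of i, where 'n='n] by (auto simp: invertible_def)
  have eps: "eps ?g = - 1" by (simp add: eps_def det_reflection)
  have "negl k {Fs \<in> ftuples k. \<beta> (restrict (\<lambda>j. act ?g (Fs j)) {..<k}) \<noteq> eps ?g * \<beta> Fs}"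
    using \<beta> inv unfolding LinfG_def equivar_def by blast
  from negl_AE[OF this] rep AE_tuple_mult[OF inv rep] show ?thesis
  proof eventually_elim
    case (elim X)
    show ?case
    proof
      assume X: "\<forall>j<k. invertible (X j)"
      have "\<forall>j<k. invertible (tuple_mult k (\<lambda>_. ?g) X j)" using X inv by (simp add: tuple_mult_def invertible_mult)
      then have "b (tuple_mult k (\<lambda>_. ?g) X) = \<beta> (tuple_of k (tuple_mult k (\<lambda>_. ?g) X))" using elim(3) by blast
      also have "\<dots> = \<beta> (restrict (\<lambda>j. act ?g (tuple_of k X j)) {..<k})" by (simp only: tuple_of_tuple_mult)
      also have "\<dots> = - \<beta> (tuple_of k X)"
        using elim(1) X tuple_of_ftuples[of k X] by (auto simp: eps)
      also have "\<dots> = - b X" using elim(2) X by simp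
      finally show "b (tuple_mult k (\<lambda>_. ?g) X) = - b X" .
    qed
  qed
qed

lemma measurable_generic_sign:
  "(\<lambda>X. generic_sign (\<lambda>j. L j ** X j)) \<in> borel_measurable (Mk (Suc CARD('n)) :: (nat \<Rightarrow> ((real,'n::{finite,linorder}) vec,'n) vec) measure)"
proof -
  let ?M = "Mk (Suc CARD('n)) :: (nat \<Rightarrow> ((real,'n) vec,'n) vec) measure"
  have ent: "(\<lambda>X. X j $ r $ c) \<in> borel_measurable ?M" if "j < Suc CARD('n)" for j and r c :: 'n
  proof -
    have "(\<lambda>A :: ((real,'n) vec,'n) vec. A $ r $ c) \<in> borel_measurable borel"
      by (intro borel_measurable_continuous_onI continuous_intros)
    from measurable_compose[OF measurable_Mk_component[OF that] this] show ?thesis .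
  qed
  have "skip i (rk c) < Suc CARD('n)" for i and c :: 'n by (rule skip_less[OF rk_less])
  then show ?thesis
    unfolding generic_sign_def det_def cols_def column_def matrix_matrix_mult_def vec_lambda_beta
    by (intro borel_measurable_prod measurable_compose[OF _ borel_measurable_sgn] borel_measurable_sum
        borel_measurable_times borel_measurable_const ent) auto
qed

lemma abs_generic_sign_le: "\<bar>generic_sign Y\<bar> \<le> 1"
  unfolding generic_sign_def abs_prod by (rule prod_le_1) (auto simp: sgn_real_def)

lemma generic_sign_cases: "generic_sign Y = 0 \<or> \<bar>generic_sign Y\<bar> = 1"
proof (cases "generic_sign Y = 0")
  case False
  then show ?thesis unfolding generic_sign_def abs_prod by (intro disjI2 prod.neutral) (simp add: abs_sgn_eq sgn_eq_0_iff)
qed simp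

text \<open>Each of the n + 1 faces contributes an exceptional set, which stays null in the larger
  tuple space by \<open>AE_face\<close>.\<close>

lemma cobound_representative:
  fixes \<beta> :: "(nat \<Rightarrow> 'n::{finite,linorder} flag) \<Rightarrow> real"
  assumes rep: "AE X in Mk n. (\<forall>j<n. invertible (X j)) \<longrightarrow> b X = \<beta> (tuple_of n X)"
  shows "AE Z in Mk (Suc n). (\<forall>j<Suc n. invertible (Z j)) \<longrightarrow>
     cobound (n + 1) \<beta> (tuple_of (Suc n) Z) = (\<Sum>i\<le>n. (-1) ^ i * b (face n i Z))"
proof -
  have "AE Z in Mk (Suc n). \<forall>i\<in>{..n}. (\<forall>j<n. invertible (face n i Z j)) \<longrightarrow>
      b (face n i Z) = \<beta> (tuple_of n (face n i Z))"
    by (intro AE_finite_allI AE_face[OF _ rep]) auto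
  then show ?thesis
  proof eventually_elim
    case (elim Z)
    show ?case
    proof
      assume Z: "\<forall>j<Suc n. invertible (Z j)"
      then have "\<forall>j<n. invertible (face n i Z j)" for i by (simp add: face_def skip_less)
      then have "b (face n i Z) = \<beta> (tuple_of n (face n i Z))" if "i \<le> n" for i using elim that by blast
      then show "cobound (n + 1) \<beta> (tuple_of (Suc n) Z) = (\<Sum>i\<le>n. (-1) ^ i * b (face n i Z))"
        unfolding cobound_tuple_of by simp
    qed
  qed
qed

lemma abs_alternating_sum_le:
  fixes x :: "nat \<Rightarrow> real"
  assumes "\<And>i. \<bar>x i\<bar> \<le> K"
  shows "\<bar>\<Sum>i\<le>n. (-1) ^ i * x i\<bar> \<le> (real n + 1) * K"
proof -
  have "\<bar>\<Sum>i\<le>n. (-1) ^ i * x i\<bar> \<le> (\<Sum>i\<le>n. \<bar>(-1) ^ i * x i\<bar>)" by (rule sum_abs)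
  also have "\<dots> \<le> of_nat (card {..n}) * K"
    using assms by (intro sum_bounded_above) (simp add: abs_mult power_abs)
  finally show ?thesis by (simp add: add.commute)
qed

lemma generic_sign_mean_tendsto:
  assumes ev: "even CARD('n::{finite,linorder})"
  shows "(\<lambda>k. \<integral>X. \<bar>vertex_sign TYPE('n) - generic_sign (\<lambda>j. frame (step k) j ** X j)\<bar>
     \<partial>(seed_tuples (Suc CARD('n)) :: (nat \<Rightarrow> ((real,'n) vec,'n) vec) measure)) \<longlonglongrightarrow> 0"
proof -
  let ?P = "seed_tuples (Suc CARD('n)) :: (nat \<Rightarrow> ((real,'n) vec,'n) vec) measure"
  interpret prob_space ?P by (rule prob_space_seed_tuples)
  have meas: "(\<lambda>X. generic_sign (\<lambda>j. L j ** X j)) \<in> borel_measurable ?P" for L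
    using measurable_generic_sign[of L] by (simp cong: measurable_cong_sets add: sets_seed_tuples)
  have "(\<lambda>k. \<integral>X. \<bar>vertex_sign TYPE('n) - generic_sign (\<lambda>j. frame (step k) j ** X j)\<bar> \<partial>?P) \<longlonglongrightarrow> (\<integral>X. (0::real) \<partial>?P)"
  proof (rule integral_dominated_convergence[where w = "\<lambda>_. 2"])
    show "AE X in ?P. (\<lambda>k. \<bar>vertex_sign TYPE('n) - generic_sign (\<lambda>j. frame (step k) j ** X j)\<bar>) \<longlonglongrightarrow> 0"
      using AE_seed_tuples_seeds[of "Suc CARD('n)"]
    proof eventually_elim
      case (elim X)
      then have "((\<lambda>h. generic_sign (\<lambda>j. frame h j ** X j)) \<longlongrightarrow> vertex_sign TYPE('n)) (at 0)"
        by (intro generic_sign_tendsto[OF ev]) auto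
      then have "(\<lambda>k. generic_sign (\<lambda>j. frame (step k) j ** X j)) \<longlonglongrightarrow> vertex_sign TYPE('n)"
        by (rule filterlim_compose[OF _ step_at_0])
      then have "(\<lambda>k. \<bar>vertex_sign TYPE('n) - generic_sign (\<lambda>j. frame (step k) j ** X j)\<bar>) \<longlonglongrightarrow> \<bar>vertex_sign TYPE('n) - vertex_sign TYPE('n)\<bar>"
        by (intro tendsto_intros)
      then show ?case by simp
    qed
    fix k
    show "(\<lambda>X. \<bar>vertex_sign TYPE('n) - generic_sign (\<lambda>j. frame (step k) j ** X j)\<bar>) \<in> borel_measurable ?P"
      using meas by (intro borel_measurable_abs borel_measurable_diff) auto
    have "\<bar>vertex_sign TYPE('n) - generic_sign Y\<bar> \<le> 2" for Y :: "nat \<Rightarrow> ((real,'n) vec,'n) vec"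
      using abs_vertex_sign[where 'n='n] abs_generic_sign_le[of Y] by linarith
    then show "AE X in ?P. norm \<bar>vertex_sign TYPE('n) - generic_sign (\<lambda>j. frame (step k) j ** X j)\<bar> \<le> 2" by simp
  qed simp_all
  then show ?thesis by simp
qed

text \<open>Along the frames with h tending to 0 the cocycle is \<open>?\<sigma>\<close> up to an
  error small in mean, so \<open>?\<sigma>\<close> times the coboundary has mean at least 1 - C in
  the limit. The mean of each face term tends to 0, hence 1 - C cannot be positive.\<close>

lemma one_le_ess_bound:
  fixes \<beta> :: "(nat \<Rightarrow> 'n::{finite,linorder} flag) \<Rightarrow> real"
  assumes ev: "even CARD('n)" and \<beta>: "\<beta> \<in> LinfG CARD('n)" and C: "0 \<le> C"
    and negl: "negl (Suc CARD('n)) {Fs \<in> ftuples (Suc CARD('n)). C < \<bar>cocA Fs - cobound (CARD('n) + 1) \<beta> Fs\<bar>}"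
  shows "1 \<le> C"
proof -
  let ?n = "CARD('n)"
  let ?P = "seed_tuples (Suc ?n) :: (nat \<Rightarrow> ((real,'n) vec,'n) vec) measure"
  let ?\<sigma> = "vertex_sign TYPE('n)"
  interpret prob_space ?P by (rule prob_space_seed_tuples)
  obtain b K where b: "b \<in> borel_measurable (Mk ?n)" and K: "\<And>X. \<bar>b X\<bar> \<le> K"
    and rep: "AE X in Mk ?n. (\<forall>j<?n. invertible (X j)) \<longrightarrow> b X = \<beta> (tuple_of ?n X)"
    using AE_bounded_representative[OF \<beta>] by blast
  define F where "F k i X = b (tuple_mult ?n (\<lambda>j. frame (step k) (skip i j)) (face ?n i X))" for k i X
  define D where "D k X = (\<Sum>i\<le>?n. (-1) ^ i * F k i X)" for k X
  define f where "f k X = generic_sign (\<lambda>j. frame (step k) j ** X j)" for k and X :: "nat \<Rightarrow> ((real,'n) vec,'n) vec"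
  \<comment> \<open>Where f differs from \<open>?\<sigma>\<close>, it does so by at least 1, so the
    penalty is at least m; this outweighs both 1 and the bound of the coboundary.\<close>
  define m where "m = (real ?n + 1) * K + 1"
  have D_le: "\<bar>D k X\<bar> \<le> (real ?n + 1) * K" for k X
    unfolding D_def F_def by (rule abs_alternating_sum_le[OF K])
  have \<sigma>: "?\<sigma> = 1 \<or> ?\<sigma> = - 1" using abs_vertex_sign[where 'n='n] by linarith
  have K0: "0 \<le> K" using K[of undefined] by linarith

  \<comment> \<open>The penalty term lets one inequality hold on the good and the bad tuples alike,
    so that it can be integrated over all seeds.\<close>
  have pointwise: "AE X in ?P. (1 - C) - m * \<bar>?\<sigma> - f k X\<bar> \<le> ?\<sigma> * D k X" for k
  proof (rule AE_seed_tuples)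
    define L where "L j = (frame (step k) j :: ((real,'n) vec,'n) vec)" for j
    have L: "invertible (L j)" for j unfolding L_def by (rule invertible_frame) simp
    show "AE X in Mk (Suc ?n). (\<forall>j<Suc ?n. X j \<in> seeds) \<longrightarrow> (1 - C) - m * \<bar>?\<sigma> - f k X\<bar> \<le> ?\<sigma> * D k X"
      using AE_tuple_mult[where T = L, OF L negl_AE[OF negl]]
        AE_tuple_mult[where T = L, OF L cobound_representative[OF rep]]
    proof eventually_elim
      case (elim X)
      show ?case
      proof
        assume XQ: "\<forall>j<Suc ?n. X j \<in> seeds"
        let ?Z = "tuple_mult (Suc ?n) L X"
        have Zinv: "\<forall>j<Suc ?n. invertible (?Z j)"
          using XQ by (simp add: tuple_mult_def invertible_mult L seeds_invertible)
        have "cobound (?n + 1) \<beta> (tuple_of (Suc ?n) ?Z) = (\<Sum>i\<le>?n. (-1) ^ i * b (face ?n i ?Z))"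
          using elim(2) Zinv by blast
        then have dD: "cobound (?n + 1) \<beta> (tuple_of (Suc ?n) ?Z) = D k X"
          unfolding D_def F_def face_tuple_mult L_def .
        have close: "\<bar>cocA (tuple_of (Suc ?n) ?Z) - D k X\<bar> \<le> C"
          using elim(1) Zinv tuple_of_ftuples[of "Suc ?n" ?Z] unfolding dD[symmetric] by auto
        show "(1 - C) - m * \<bar>?\<sigma> - f k X\<bar> \<le> ?\<sigma> * D k X"
        proof (cases "f k X = ?\<sigma>")
          case True
          \<comment> \<open>A nonzero value of f means that all face determinants are nonzero, as
            \<open>cocA_generic\<close> demands. Multiplying \<open>close\<close> by the sign then
            gives the inequality.\<close>
          have "cocA (tuple_of (Suc ?n) ?Z) = (\<Prod>i\<le>?n. sgn (det (cols (\<lambda>l. column (unrk 0) (L (skip i l) ** X (skip i l))) :: ((real,'n) vec,'n) vec)))"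
          proof (rule cocA_generic[OF ev, where gs = "\<lambda>j. L j ** X j"])
            fix i assume i: "i \<le> ?n"
            then show "invertible (L i ** X i)"
              using XQ by (intro invertible_mult L seeds_invertible) auto
            show "tuple_of (Suc ?n) ?Z i = flag_of (L i ** X i)"
              using i by (simp add: tuple_of_def tuple_mult_def)
            have "f k X \<noteq> 0" using True \<sigma> by auto
            then show "det (cols (\<lambda>l. column (unrk 0) (L (skip i l) ** X (skip i l))) :: ((real,'n) vec,'n) vec) \<noteq> 0"
              using i unfolding f_def generic_sign_def L_def by (auto simp: sgn_eq_0_iff)
          qed
          then have "cocA (tuple_of (Suc ?n) ?Z) = ?\<sigma>"
            using True by (simp add: f_def generic_sign_def L_def)
          then show ?thesis using close \<sigma> True by auto
        next
          case False
          have "1 \<le> \<bar>?\<sigma> - f k X\<bar>"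
            using False \<sigma> generic_sign_cases[of "\<lambda>j. frame (step k) j ** X j"] unfolding f_def[symmetric]
            by linarith
          moreover have "m \<ge> 0" using K0 by (simp add: m_def)
          ultimately have "m * 1 \<le> m * \<bar>?\<sigma> - f k X\<bar>" by (rule mult_left_mono)
          moreover have "- ((real ?n + 1) * K) \<le> ?\<sigma> * D k X" using D_le[of k X] \<sigma> by auto
          ultimately show ?thesis using C by (simp add: m_def)
        qed
      qed
    qed
  qed

  have meas_b: "(\<lambda>Y. b (tuple_mult ?n L Y)) \<in> borel_measurable (Mk ?n)" for L
    by (rule measurable_compose[OF measurable_tuple_mult b])
  have meas_b': "(\<lambda>Y. b (tuple_mult ?n L Y)) \<in> borel_measurable (seed_tuples ?n)" for L
    using meas_b by (simp cong: measurable_cong_sets add: sets_seed_tuples)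
  have F_int: "integrable ?P (F k i)" for k i
  proof (rule integrable_const_bound[where B = K])
    show "F k i \<in> borel_measurable ?P"
      unfolding F_def[abs_def] by (rule measurable_compose[OF measurable_face_seed_tuples meas_b'])
    show "AE X in ?P. norm (F k i X) \<le> K" by (simp add: F_def K)
  qed
  \<comment> \<open>A face of the random tuple is again a tuple of independent seeds, which reduces
    the mean to the integral in \<open>face_integral_bound\<close>.\<close>
  have F_mean: "(\<integral>X. F k i X \<partial>?P) = (\<integral>Y. b (tuple_mult ?n (\<lambda>j. frame (step k) (skip i j)) Y) \<partial>seed_tuples ?n)" for k i
    unfolding F_def
    by (subst (2) distr_face_seed_tuples[symmetric, of _ i], subst integral_distr[OF measurable_face_seed_tuples meas_b']) simp
  have F_lim: "(\<lambda>k. \<integral>X. F k i X \<partial>?P) \<longlonglongrightarrow> 0" if "i \<le> ?n" for i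
  proof (rule Lim_null_comparison)
    show "eventually (\<lambda>k. norm (\<integral>X. F k i X \<partial>?P)
        \<le> K * (\<integral>X. (1 - indicator (stay (step k) i) X) \<partial>(seed_tuples ?n :: (nat \<Rightarrow> ((real,'n) vec,'n) vec) measure))) sequentially"
      unfolding F_mean real_norm_def
      by (intro always_eventually allI face_integral_bound[OF _ that b K representative_anti_invariant[OF \<beta> rep]]) simp
    show "(\<lambda>k. K * (\<integral>X. (1 - indicator (stay (step k) i) X) \<partial>(seed_tuples ?n :: (nat \<Rightarrow> ((real,'n) vec,'n) vec) measure))) \<longlonglongrightarrow> 0"
      by (rule tendsto_mult_right_zero[OF stay_tendsto])
  qed
  have D_int: "integrable ?P (D k)" for k
    unfolding D_def[abs_def] using F_int by (intro Bochner_Integration.integrable_sum integrable_mult_right) auto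
  have D_mean: "(\<integral>X. D k X \<partial>?P) = (\<Sum>i\<le>?n. (-1) ^ i * (\<integral>X. F k i X \<partial>?P))" for k
    unfolding D_def using F_int by (subst Bochner_Integration.integral_sum) (auto intro: integrable_mult_right)
  have "(\<lambda>k. ?\<sigma> * (\<Sum>i\<le>?n. (-1) ^ i * (\<integral>X. F k i X \<partial>?P))) \<longlonglongrightarrow> ?\<sigma> * (\<Sum>i\<le>?n. (-1) ^ i * 0)"
    using F_lim by (intro tendsto_intros) auto
  then have lim1: "(\<lambda>k. ?\<sigma> * (\<integral>X. D k X \<partial>?P)) \<longlonglongrightarrow> 0" by (simp add: D_mean)
  have f_int: "integrable ?P (\<lambda>X. \<bar>?\<sigma> - f k X\<bar>)" for k
  proof (rule integrable_const_bound[where B = 2])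
    show "(\<lambda>X. \<bar>?\<sigma> - f k X\<bar>) \<in> borel_measurable ?P"
      using measurable_generic_sign[of "frame (step k) :: nat \<Rightarrow> ((real,'n) vec,'n) vec"] unfolding f_def
      by (intro borel_measurable_abs borel_measurable_diff) (auto cong: measurable_cong_sets simp: sets_seed_tuples)
    have "\<bar>?\<sigma> - f k X\<bar> \<le> 2" for X
      using abs_vertex_sign[where 'n='n] abs_generic_sign_le[of "\<lambda>j. frame (step k) j ** X j"] unfolding f_def by linarith
    then show "AE X in ?P. norm \<bar>?\<sigma> - f k X\<bar> \<le> 2" by simp
  qed
  have "(\<lambda>k. (1 - C) - m * (\<integral>X. \<bar>?\<sigma> - f k X\<bar> \<partial>?P)) \<longlonglongrightarrow> (1 - C) - m * 0"
    unfolding f_def using generic_sign_mean_tendsto[OF ev] by (intro tendsto_intros)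
  then have lim2: "(\<lambda>k. (1 - C) - m * (\<integral>X. \<bar>?\<sigma> - f k X\<bar> \<partial>?P)) \<longlonglongrightarrow> 1 - C" by simp
  have "(1 - C) - m * (\<integral>X. \<bar>?\<sigma> - f k X\<bar> \<partial>?P) \<le> ?\<sigma> * (\<integral>X. D k X \<partial>?P)" for k
  proof -
    have "(\<integral>X. (1 - C) - m * \<bar>?\<sigma> - f k X\<bar> \<partial>?P) \<le> (\<integral>X. ?\<sigma> * D k X \<partial>?P)"
      using f_int D_int pointwise[of k] by (intro integral_mono_AE) auto
    then show ?thesis using f_int by (simp add: prob_space)
  qed
  then have "1 - C \<le> 0" by (intro LIMSEQ_le[OF lim2 lim1]) auto
  then show ?thesis by simp
qed

text \<open>The essential norm is an infimum of reals, for which lower bounds are meaningful only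
  once the set of admissible constants is nonempty.\<close>

lemma ess_bounded_cocA_minus_cobound:
  fixes \<beta> :: "(nat \<Rightarrow> 'n::{finite,linorder} flag) \<Rightarrow> real"
  assumes \<beta>: "\<beta> \<in> LinfG CARD('n)"
  shows "\<exists>C\<ge>0. negl (Suc CARD('n)) {Fs \<in> ftuples (Suc CARD('n)). C < \<bar>cocA Fs - cobound (CARD('n) + 1) \<beta> Fs\<bar>}"
proof -
  let ?n = "CARD('n)"
  obtain b K where K: "\<And>X. \<bar>b X\<bar> \<le> K"
    and rep: "AE X in Mk ?n. (\<forall>j<?n. invertible (X j)) \<longrightarrow> b X = \<beta> (tuple_of ?n X)"
    using AE_bounded_representative[OF \<beta>] by blast
  have K0: "0 \<le> K" using K[of undefined] by linarith
  let ?C = "1 + (real ?n + 1) * K"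
  have "negl (Suc ?n) {Fs \<in> ftuples (Suc ?n). ?C < \<bar>cocA Fs - cobound (?n + 1) \<beta> Fs\<bar>}"
  proof (rule AE_negl)
    show "AE Z in Mk (Suc ?n). (\<forall>j<Suc ?n. invertible (Z j)) \<longrightarrow>
       tuple_of (Suc ?n) Z \<notin> {Fs \<in> ftuples (Suc ?n). ?C < \<bar>cocA Fs - cobound (?n + 1) \<beta> Fs\<bar>}"
      using cobound_representative[OF rep]
    proof eventually_elim
      case (elim Z)
      show ?case
      proof
        assume Z: "\<forall>j<Suc ?n. invertible (Z j)"
        have "\<bar>cobound (?n + 1) \<beta> (tuple_of (Suc ?n) Z)\<bar> \<le> (real ?n + 1) * K"
          using elim Z abs_alternating_sum_le[of "\<lambda>i. b (face ?n i Z)" K ?n] K by simp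
        moreover have "\<bar>cocA (tuple_of (Suc ?n) Z)\<bar> \<le> 1"
          using Z by (intro abs_cocA_le_1) (simp add: tuple_of_def is_flag_flag_of)
        ultimately have "\<bar>cocA (tuple_of (Suc ?n) Z) - cobound (?n + 1) \<beta> (tuple_of (Suc ?n) Z)\<bar> \<le> ?C"
          by linarith
        then show "tuple_of (Suc ?n) Z \<notin> {Fs \<in> ftuples (Suc ?n). ?C < \<bar>cocA Fs - cobound (?n + 1) \<beta> Fs\<bar>}"
          by simp
      qed
    qed
  qed
  moreover have "0 \<le> ?C" using K0 by simp
  ultimately show ?thesis by blast
qed

lemma negl_empty: "negl k {}"
  by (rule AE_negl) simp

lemma zero_LinfG: "(\<lambda>_. 0) \<in> LinfG k"
  unfolding LinfG_def fmeas_def ess_bdd_def equivar_def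
  using negl_empty by (auto intro!: exI[of _ 0])

theorem theorem6p1:
  assumes "even CARD('n::{finite,linorder})"
  shows "qA_norm TYPE('n) = 1"
proof -
  let ?n = "CARD('n)"
  let ?B = "\<lambda>\<beta> :: (nat \<Rightarrow> 'n flag) \<Rightarrow> real.
    {C. 0 \<le> C \<and> negl (?n + 1) {Fs \<in> ftuples (?n + 1). C < \<bar>cocA Fs - cobound (?n + 1) \<beta> Fs\<bar>}}"
  let ?N = "\<lambda>\<beta> :: (nat \<Rightarrow> 'n flag) \<Rightarrow> real.
    ess_norm (?n + 1) (\<lambda>Fs. cocA Fs - cobound (?n + 1) \<beta> Fs)"
  have lower: "1 \<le> ?N \<beta>" if "\<beta> \<in> LinfG ?n" for \<beta> :: "(nat \<Rightarrow> 'n flag) \<Rightarrow> real"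
    unfolding ess_norm_def
  proof (rule cInf_greatest)
    show "?B \<beta> \<noteq> {}" using ess_bounded_cocA_minus_cobound[OF that] by auto
    show "1 \<le> C" if "C \<in> ?B \<beta>" for C
      using one_le_ess_bound[OF assms \<open>\<beta> \<in> LinfG ?n\<close>, of C] that by simp
  qed
  have upper: "?N (\<lambda>_. 0) \<le> 1"
    unfolding ess_norm_def
  proof (rule cInf_lower)
    \<comment> \<open>For the zero cochain the bound \<open>abs_cocA_le_1\<close> holds at every
      tuple of flags, so the exceptional set is empty.\<close>
    have empty: "{Fs \<in> ftuples (?n + 1). 1 < \<bar>cocA Fs - cobound (?n + 1) (\<lambda>_. 0) Fs\<bar>} = ({} :: (nat \<Rightarrow> 'n flag) set)"
    proof -
      have "\<bar>cocA Fs\<bar> \<le> 1" if "Fs \<in> ftuples (?n + 1)" for Fs :: "nat \<Rightarrow> 'n flag"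
        using that by (intro abs_cocA_le_1) (auto simp: ftuples_def flags_def PiE_iff)
      then show ?thesis by (force simp: cobound_def)
    qed
    show "1 \<in> ?B (\<lambda>_. 0)" unfolding mem_Collect_eq empty by (simp add: negl_empty)
    show "bdd_below (?B (\<lambda>_. 0))" by (rule bdd_belowI[of _ 0]) simp
  qed
  \<comment> \<open>The infimum over cochains is therefore a minimum, attained at zero.\<close>
  have "?N (\<lambda>_. 0) = 1" using upper lower[OF zero_LinfG] by linarith
  then show ?thesis
    unfolding qA_norm_def using zero_LinfG lower
    by (intro cInf_eq_minimum) (auto intro!: exI[of _ "\<lambda>_. 0"])
qed

end
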